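(* For every pair of integers $n\geqslant6$ and $2\leqslant k\leqslant n-4$, there exists a Griffiths positive Hermitian $k\times k$ matrix $M$ of constant $(1,1)$-forms on $\mathbb{C}^n$ satisfying the simultaneous diagonalizability (SD) condition such that the Lefschetz map $L_{\det M}^{2,n-k-2}$ is singular (not an isomorphism). In particular, $\det M$ does not belong to the Hodge--Riemann cone (for any choice of Kähler reference form $\omega$).
   Context: Let $V=\mathbb{C}^n$, and let $V^{p,q}=\Lambda^pV^*\otimes\Lambda^q\overline{V^*}$ be the space of constant-coefficient $(p,q)$-forms. For $\Omega\in V^{k,k}$ and nonnegative integers $p,q$ with $p+q=n-k$, the Lefschetz map is $L_\Omega^{p,q}\colon V^{p,q}\to V^{n-q,n-p}$, $\alpha\mapsto\alpha\wedge\Omega$. A Hermitian $k\times k$ matrix of constant $(1,1)$-forms is $M=(\alpha_{ab})_{a,b=1}^k$ with $\alpha_{ba}=\overline{\alpha_{ab}}$. Since $(1,1)$-forms commute under the wedge product, $\det M$ is defined by the usual permutation formula; it is a real $(k,k)$-form. A real constant $(1,1)$-form is Kähler (positive) if its associated Hermitian form is positive definite, i.e. it equals $\frac{\sqrt{-1}}{2}\sum_j dw_j\wedge d\bar w_j$ in some complex linear coordinates. $M$ is Griffiths positive if $\sum_{a,b}\theta_a\overline{\theta_b}\,\alpha_{ab}$ is Kähler for every $0\ne\theta\in\mathbb{C}^k$. $M$ satisfies the SD condition if there are complex linear coordinates $z_1,\dots,z_n$ on $\mathbb{C}^n$ such that $M=\sum_{j=1}^nB_jV_j$, where $V_j=\frac{\sqrt{-1}}{2}dz_j\wedge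 d\bar z_j$ and each $B_j=B_j^*$ is a constant Hermitian $k\times k$ matrix (the $B_j$ need not commute). Fix a Kähler reference form $\omega$. A real $(k,k)$-form $\Omega$ is Lefschetz for $(p,q)$ (where $p+q=n-k$) if $L_\Omega^{p,q}$ is an isomorphism. It is Hodge--Riemann for $(p,q)$ if there is a continuous path of real $(k,k)$-forms $\Omega_t$, $0\leqslant t\leqslant1$, with $\Omega_0=\Omega$, $\Omega_1=\omega^k$, such that $\Omega_t\wedge\omega^{2r}$ is Lefschetz for $(p-r,q-r)$ for every integer $0\leqslant r\leqslant\min\{p,q\}$ and every $t\in[0,1]$. It belongs to the Hodge--Riemann cone if it is Hodge--Riemann for $(p,q)$ for every $p+q=n-k$. *)

theory Defs
  imports "HOL-Analysis.Function_Topology" "Jordan_Normal_Form.Schur_Decomposition"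
begin

text \<open>
  Constant-coefficient forms on \<open>\<complex>\<^sup>n\<close> are given by their coefficients: \<open>\<alpha> I J\<close> is the coefficient
  of \<open>dx\<^sub>I \<and> dx\<^sup>*\<^sub>J\<close>, where \<open>x\<^sub>0, \<dots>, x\<^sub>n\<^sub>-\<^sub>1\<close> are the standard coordinates and, for
  \<open>I = {i\<^sub>1 < \<dots> < i\<^sub>p}\<close>, \<open>dx\<^sub>I = dx\<^sub>i\<^sub>1 \<and> \<dots> \<and> dx\<^sub>i\<^sub>p\<close> (likewise for
  the conjugate differentials \<open>dx\<^sup>*\<^sub>j\<close>).
\<close>

type_synonym form = "nat set \<Rightarrow> nat set \<Rightarrow> complex"

definition forms :: "nat \<Rightarrow> nat \<Rightarrow> nat \<Rightarrow> form set" where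
  "forms n p q = {\<alpha>. \<forall>I J. \<alpha> I J \<noteq> 0 \<longrightarrow>
     I \<subseteq> {..<n} \<and> J \<subseteq> {..<n} \<and> card I = p \<and> card J = q}"

text \<open>For disjoint \<open>A\<close>, \<open>B\<close>: \<open>dx\<^sub>A \<and> dx\<^sub>B = shuffle_sign A B \<cdot> dx\<^sub>A\<^sub>\<union>\<^sub>B\<close>.\<close>

definition shuffle_sign :: "nat set \<Rightarrow> nat set \<Rightarrow> complex" where
  "shuffle_sign A B = (-1) ^ card {(a, b). a \<in> A \<and> b \<in> B \<and> b < a}"

text \<open>
  The factor \<open>(-1) ^ (card J1 * card (I - I1))\<close> comes from moving \<open>dx\<^sup>*\<^sub>J\<^sub>1\<close> past \<open>dx\<^sub>I\<^sub>-\<^sub>I\<^sub>1\<close> in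
  \<open>(dx\<^sub>I\<^sub>1 \<and> dx\<^sup>*\<^sub>J\<^sub>1) \<and> (dx\<^sub>I\<^sub>-\<^sub>I\<^sub>1 \<and> dx\<^sup>*\<^sub>J\<^sub>-\<^sub>J\<^sub>1)\<close>.
\<close>

definition wedge :: "form \<Rightarrow> form \<Rightarrow> form" where
  "wedge \<alpha> \<beta> = (\<lambda>I J. \<Sum>I1\<in>Pow I. \<Sum>J1\<in>Pow J.
     (-1) ^ (card J1 * card (I - I1)) * shuffle_sign I1 (I - I1) * shuffle_sign J1 (J - J1)
       * \<alpha> I1 J1 * \<beta> (I - I1) (J - J1))"

definition form_one :: form where
  "form_one = (\<lambda>I J. if I = {} \<and> J = {} then 1 else 0)"

definition wedge_list :: "form list \<Rightarrow> form" where
  "wedge_list \<alpha>s = foldr wedge \<alpha>s form_one"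

definition wedge_power :: "form \<Rightarrow> nat \<Rightarrow> form" where
  "wedge_power \<alpha> m = wedge_list (replicate m \<alpha>)"

text \<open>The sign is that of \<open>dx\<^sup>*\<^sub>J \<and> dx\<^sub>I = (-1) ^ (card I * card J) \<cdot> dx\<^sub>I \<and> dx\<^sup>*\<^sub>J\<close>.\<close>

definition form_cnj :: "form \<Rightarrow> form" where
  "form_cnj \<alpha> = (\<lambda>I J. (-1) ^ (card I * card J) * cnj (\<alpha> J I))"

definition real_forms :: "nat \<Rightarrow> nat \<Rightarrow> form set" where
  "real_forms n k = {\<alpha> \<in> forms n k k. form_cnj \<alpha> = \<alpha>}"

text \<open>
  The Hermitian form associated with \<open>\<alpha> = (\<i> / 2) \<Sum>\<^sub>i\<^sub>,\<^sub>j h\<^sub>i\<^sub>j dx\<^sub>i \<and> dx\<^sup>*\<^sub>j\<close> is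
  \<open>\<Sum>\<^sub>i\<^sub>,\<^sub>j h\<^sub>i\<^sub>j u\<^sub>i (cnj v\<^sub>j)\<close>.
\<close>

definition assoc_hermitian :: "nat \<Rightarrow> form \<Rightarrow> complex vec \<Rightarrow> complex vec \<Rightarrow> complex" where
  "assoc_hermitian n \<alpha> u v =
     (\<Sum>i<n. \<Sum>j<n. (2 / \<i>) * \<alpha> {i} {j} * u $ i * cnj (v $ j))"

text \<open>For real \<open>\<alpha>\<close> the value \<open>assoc_hermitian n \<alpha> u u\<close> is real.\<close>

definition kaehler :: "nat \<Rightarrow> form \<Rightarrow> bool" where
  "kaehler n \<alpha> \<longleftrightarrow> \<alpha> \<in> real_forms n 1 \<and>
     (\<forall>u \<in> carrier_vec n. u \<noteq> 0\<^sub>v n \<longrightarrow> Re (assoc_hermitian n \<alpha> u u) > 0)"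

definition hermitian_form_mat :: "nat \<Rightarrow> nat \<Rightarrow> form mat \<Rightarrow> bool" where
  "hermitian_form_mat n k M \<longleftrightarrow> M \<in> carrier_mat k k \<and>
     (\<forall>a<k. \<forall>b<k. M $$ (a, b) \<in> forms n 1 1 \<and> M $$ (b, a) = form_cnj (M $$ (a, b)))"

definition form_det :: "form mat \<Rightarrow> form" where
  "form_det M = (\<lambda>I J. \<Sum>\<pi> | \<pi> permutes {..<dim_row M}.
     of_int (sign \<pi>) * wedge_list (map (\<lambda>a. M $$ (a, \<pi> a)) [0..<dim_row M]) I J)"

definition griffiths_positive :: "nat \<Rightarrow> nat \<Rightarrow> form mat \<Rightarrow> bool" where
  "griffiths_positive n k M \<longleftrightarrow> (\<forall>\<theta> \<in> carrier_vec k. \<theta> \<noteq> 0\<^sub>v k \<longrightarrow>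
     kaehler n (\<lambda>I J. \<Sum>a<k. \<Sum>b<k. \<theta> $ a * cnj (\<theta> $ b) * (M $$ (a, b)) I J))"

text \<open>
  An invertible matrix \<open>A\<close> encodes the complex linear coordinates \<open>z\<^sub>j = \<Sum>\<^sub>i A\<^sub>j\<^sub>i x\<^sub>i\<close>.
\<close>

definition coord_form :: "nat \<Rightarrow> complex mat \<Rightarrow> nat \<Rightarrow> form" where
  "coord_form n A j = (\<lambda>I J. \<Sum>i<n. if I = {i} \<and> J = {} then A $$ (j, i) else 0)"

definition coord_volume :: "nat \<Rightarrow> complex mat \<Rightarrow> nat \<Rightarrow> form" where
  "coord_volume n A j =
     (\<lambda>I J. (\<i> / 2) * wedge (coord_form n A j) (form_cnj (coord_form n A j)) I J)"

definition SD :: "nat \<Rightarrow> nat \<Rightarrow> form mat \<Rightarrow> bool" where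
  "SD n k M \<longleftrightarrow> (\<exists>A B. A \<in> carrier_mat n n \<and> invertible_mat A \<and>
     (\<forall>j<n. B j \<in> carrier_mat k k \<and> mat_adjoint (B j) = B j) \<and>
     (\<forall>a<k. \<forall>b<k. M $$ (a, b) = (\<lambda>I J. \<Sum>j<n. B j $$ (a, b) * coord_volume n A j I J)))"

definition lefschetz_map :: "form \<Rightarrow> form \<Rightarrow> form" where
  "lefschetz_map \<Omega> \<alpha> = wedge \<alpha> \<Omega>"

text \<open>
  The degree of \<open>\<Omega>\<close> is implicit: \<open>lefschetz n p q\<close> is meant for \<open>(n - p - q, n - p - q)\<close>-forms,
  for which the linear map \<open>lefschetz_map \<Omega>\<close> sends \<open>forms n p q\<close> into
  \<open>forms n (n - q) (n - p)\<close>; see \<open>lefschetz_map_in_forms\<close> below.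
\<close>

definition lefschetz :: "nat \<Rightarrow> nat \<Rightarrow> nat \<Rightarrow> form \<Rightarrow> bool" where
  "lefschetz n p q \<Omega> \<longleftrightarrow> bij_betw (lefschetz_map \<Omega>) (forms n p q) (forms n (n - q) (n - p))"

text \<open>
  Continuity below refers to the product topology on \<^typ>\<open>form\<close>, which on the finite-dimensional
  space \<open>real_forms n k\<close> is the usual one.
\<close>

definition hodge_riemann :: "nat \<Rightarrow> nat \<Rightarrow> form \<Rightarrow> nat \<Rightarrow> nat \<Rightarrow> form \<Rightarrow> bool" where
  "hodge_riemann n k \<omega> p q \<Omega> \<longleftrightarrow> (\<exists>\<gamma> :: real \<Rightarrow> form.
     continuous_on {0..1} \<gamma> \<and> \<gamma> 0 = \<Omega> \<and> \<gamma> 1 = wedge_power \<omega> k \<and>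
     (\<forall>t\<in>{0..1}. \<gamma> t \<in> real_forms n k \<and>
       (\<forall>r\<le>min p q. lefschetz n (p - r) (q - r) (wedge (\<gamma> t) (wedge_power \<omega> (2 * r))))))"

definition hodge_riemann_cone :: "nat \<Rightarrow> nat \<Rightarrow> form \<Rightarrow> form set" where
  "hodge_riemann_cone n k \<omega> =
     {\<Omega> \<in> real_forms n k. \<forall>p q. p + q + k = n \<longrightarrow> hodge_riemann n k \<omega> p q \<Omega>}"

lemma wedge_in_forms:
  assumes "\<alpha> \<in> forms n p q" "\<beta> \<in> forms n r s"
  shows "wedge \<alpha> \<beta> \<in> forms n (p + r) (q + s)"
proof -
  have "I \<subseteq> {..<n} \<and> J \<subseteq> {..<n} \<and> card I = p + r \<and> card J = q + s"
    if nz: "wedge \<alpha> \<beta> I J \<noteq> 0" for I J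
  proof -
    obtain I1 where I1: "I1 \<subseteq> I" and nz1: "(\<Sum>J1\<in>Pow J.
        (-1) ^ (card J1 * card (I - I1)) * shuffle_sign I1 (I - I1) * shuffle_sign J1 (J - J1)
        * \<alpha> I1 J1 * \<beta> (I - I1) (J - J1)) \<noteq> 0"
      using sum.not_neutral_contains_not_neutral[OF nz[unfolded wedge_def]] by blast
    obtain J1 where J1: "J1 \<subseteq> J" and nz2: "\<alpha> I1 J1 \<noteq> 0" "\<beta> (I - I1) (J - J1) \<noteq> 0"
      using sum.not_neutral_contains_not_neutral[OF nz1] by auto
    have a: "I1 \<subseteq> {..<n}" "J1 \<subseteq> {..<n}" "card I1 = p" "card J1 = q"
      using assms(1) nz2(1) unfolding forms_def by blast+
    have b: "I - I1 \<subseteq> {..<n}" "J - J1 \<subseteq> {..<n}" "card (I - I1) = r" "card (J - J1) = s"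
      using assms(2) nz2(2) unfolding forms_def by blast+
    have sub: "I \<subseteq> {..<n}" "J \<subseteq> {..<n}" using a b by blast+
    then have "finite I" "finite J" by (auto intro: finite_subset)
    then have "card I = card I1 + card (I - I1)" "card J = card J1 + card (J - J1)"
      using I1 J1 by (metis card_Diff_subset card_mono finite_subset le_add_diff_inverse)+
    with a b sub show ?thesis by simp
  qed
  then show ?thesis unfolding forms_def by blast
qed

lemma lefschetz_map_in_forms:
  assumes "p + q + k = n" "\<Omega> \<in> forms n k k" "\<alpha> \<in> forms n p q"
  shows "lefschetz_map \<Omega> \<alpha> \<in> forms n (n - q) (n - p)"
proof -
  have "n - q = p + k" "n - p = q + k" using assms(1) by auto
  then show ?thesis
    using wedge_in_forms[OF assms(3,2)] by (simp add: lefschetz_map_def)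
qed

end

theory Submission
  imports Defs
begin

text \<open>
  In standard coordinates let \<open>M = \<Sum>\<^sub>j B\<^sub>j V\<^sub>j\<close> with \<open>B\<^sub>j\<close> the direct sum of a \<open>2 \<times> 2\<close> block \<open>C\<^sub>j\<close> and an
  identity block of size \<open>m = k - 2\<close>. Then \<open>det M\<close> has the coefficient
  \<open>m! \<Sum>\<^sub>i\<^sub>\<noteq>\<^sub>j\<^sub>\<in>\<^sub>S c\<^sub>i\<^sub>j\<close> at \<open>V\<^sub>S\<close>, where \<open>c\<close> is the polarised \<open>2 \<times> 2\<close> determinant, a Lorentzian form.
  The first six indices are split into three pairs whose blocks sit symmetrically around the time
  axis: \<open>c\<^sub>i\<^sub>j = 1 - t\<close> within a pair and \<open>1 + t / 2\<close> across pairs. All other blocks are \<open>s\<close> times the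
  identity.

  Wedging with \<open>det M\<close> preserves the span of the forms \<open>dx\<^sub>A \<and> dx\<^sup>*\<^sub>A \<and> dx\<^sup>*\<^sub>Q\<close>, where \<open>Q\<close> consists of the
  indices \<open>\<ge> k + 4\<close> and \<open>A\<close> is disjoint from \<open>Q\<close>. For pairs \<open>A\<close> and combinations invariant under the
  symmetries of the configuration it acts by a matrix of size at most 4, one row and column per
  type of pair. For \<open>s = 0\<close> its determinant is a nonzero multiple of \<open>t\<^sup>2 + 4 t - 2\<close> and changes sign
  at \<open>t = \<surd>6 - 2\<close>, within the positive range \<open>t < 1\<close>; by continuity it still vanishes for some \<open>t\<close>
  when \<open>s > 0\<close> is small, and then all \<open>B\<^sub>j\<close> are positive definite.
\<close>

subsection \<open>The symmetric configuration and its kernel\<close>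

text \<open>
  Classes 0, 1, 2 are the three pairs among the indices below 6; class 3 is everything else.
\<close>

definition cls :: "nat \<Rightarrow> nat" where
  "cls i = (if i < 6 then i mod 3 else 3)"

definition pair_type :: "nat \<Rightarrow> nat \<Rightarrow> nat" where
  "pair_type p q = (if p = 3 \<and> q = 3 then 3 else if p = 3 \<or> q = 3 then 2 else if p = q then 0 else 1)"

definition gram :: "real \<Rightarrow> real \<Rightarrow> nat \<Rightarrow> nat \<Rightarrow> real" where
  "gram s t p q = (if p = 3 \<and> q = 3 then s\<^sup>2 else if p = 3 \<or> q = 3 then s
     else if p = q then 1 - t else 1 + t / 2)"

text \<open>For class counts \<open>\<nu>\<close>, the factor
  \<open>\<nu> p * (\<nu> q - of_bool (p = q))\<close> is the number of ordered pairs of distinct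
  members with classes \<open>p\<close> and \<open>q\<close>.\<close>

definition pair_sum :: "(nat \<Rightarrow> nat \<Rightarrow> real) \<Rightarrow> (nat \<Rightarrow> real) \<Rightarrow> real" where
  "pair_sum h \<nu> = (\<Sum>p<4. \<Sum>q<4. h p q * (\<nu> p * (\<nu> q - of_bool (p = q))))"

definition remove_pair :: "(nat \<Rightarrow> real) \<Rightarrow> nat \<Rightarrow> nat \<Rightarrow> nat \<Rightarrow> real" where
  "remove_pair \<nu> p q = (\<lambda>r. \<nu> r - of_bool (p = r) - of_bool (q = r))"

text \<open>
  If \<open>\<nu>\<close> counts the members of a set \<open>U\<close> in each class, this is (up to a constant) the coefficient
  at \<open>U\<close> of the product of \<open>det M\<close> with the degree-two element of weights \<open>v\<close>.
\<close>

definition mult_sum :: "real \<Rightarrow> real \<Rightarrow> (nat \<Rightarrow> real) \<Rightarrow> (nat \<Rightarrow> real) \<Rightarrow> real" where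
  "mult_sum s t v \<nu> =
     pair_sum (\<lambda>p q. v (pair_type p q) * pair_sum (gram s t) (remove_pair \<nu> p q)) \<nu>"

text \<open>These are the class counts of the first \<open>m + 6 = k + 4\<close> indices, where
  \<open>m = k - 2\<close>.\<close>

definition class_sizes :: "nat \<Rightarrow> nat \<Rightarrow> real" where
  "class_sizes m = (\<lambda>r. if r = 3 then real m else if r < 3 then 2 else 0)"

lemma sum_lessThan_4: "(\<Sum>i<4. f i) = f 0 + f 1 + f 2 + f (3::nat)" for f :: "nat \<Rightarrow> 'a::comm_monoid_add"
  by (simp add: eval_nat_numeral add.assoc)

text \<open>Here \<open>x\<close> counts ordered pairs within one of the classes 0, 1, 2, and
  \<open>y\<close> unordered pairs across two of them, whence the doubled coefficient
  \<open>2 + t\<close>; \<open>z\<close> and \<open>w\<close> count the members inside and outside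
  these classes.\<close>

definition gram_sum :: "real \<Rightarrow> real \<Rightarrow> real \<Rightarrow> real \<Rightarrow> real \<Rightarrow> real \<Rightarrow> real" where
  "gram_sum s t x y z w = (1 - t) * x + (2 + t) * y + 2 * s * z * w + s\<^sup>2 * (w * (w - 1))"

lemma pair_sum_gram:
  "pair_sum (gram s t) \<nu> = gram_sum s t
     (\<nu> 0 * (\<nu> 0 - 1) + \<nu> 1 * (\<nu> 1 - 1) + \<nu> 2 * (\<nu> 2 - 1))
     (\<nu> 0 * \<nu> 1 + \<nu> 0 * \<nu> 2 + \<nu> 1 * \<nu> 2) (\<nu> 0 + \<nu> 1 + \<nu> 2) (\<nu> 3)"
  unfolding pair_sum_def gram_def sum_lessThan_4 gram_sum_def
  by (simp add: field_simps)

text \<open>One representative of each pair type. A set \<open>U\<close> of \<open>m + 4\<close>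
  among the first \<open>m + 6\<close> indices is the complement of a pair, so rows are indexed by
  pair types just as columns are.\<close>

definition row_class :: "nat \<Rightarrow> nat \<times> nat" where
  "row_class i = (if i = 0 then (0, 0) else if i = 1 then (0, 1) else if i = 2 then (0, 3) else (3, 3))"

text \<open>
  Pairs of type \<open>> m + 1\<close> do not occur when \<open>m < 2\<close>; their rows are replaced by unit rows, which force
  the corresponding entries of a kernel vector to vanish.
\<close>

definition mult_mat :: "nat \<Rightarrow> real \<Rightarrow> real \<Rightarrow> real mat" where
  "mult_mat m s t = mat 4 4 (\<lambda>(i, j). if i \<le> m + 1
     then mult_sum s t (\<lambda>l. of_bool (l = j))
        (remove_pair (class_sizes m) (fst (row_class i)) (snd (row_class i)))
     else of_bool (i = j))"

lemma remove_pair_commute: "remove_pair \<nu> q p = remove_pair \<nu> p q"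
  by (simp add: remove_pair_def fun_eq_iff)

lemma mult_sum_expand:
  fixes s t :: real and \<nu> :: "nat \<Rightarrow> real"
  defines "g \<equiv> \<lambda>p q. pair_sum (gram s t) (remove_pair \<nu> p q)"
  shows "mult_sum s t v \<nu> =
    v 0 * (\<nu> 0 * (\<nu> 0 - 1) * g 0 0 + \<nu> 1 * (\<nu> 1 - 1) * g 1 1 + \<nu> 2 * (\<nu> 2 - 1) * g 2 2)
    + 2 * v 1 * (\<nu> 0 * \<nu> 1 * g 0 1 + \<nu> 0 * \<nu> 2 * g 0 2 + \<nu> 1 * \<nu> 2 * g 1 2)
    + 2 * v 2 * \<nu> 3 * (\<nu> 0 * g 0 3 + \<nu> 1 * g 1 3 + \<nu> 2 * g 2 3)
    + v 3 * (\<nu> 3 * (\<nu> 3 - 1) * g 3 3)"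
proof -
  have "g 1 0 = g 0 1" "g 2 0 = g 0 2" "g 2 1 = g 1 2" "g 3 0 = g 0 3" "g 3 1 = g 1 3" "g 3 2 = g 2 3"
    unfolding g_def by (simp_all only: remove_pair_commute)
  moreover have "mult_sum s t v \<nu> = pair_sum (\<lambda>p q. v (pair_type p q) * g p q) \<nu>"
    by (simp only: mult_sum_def g_def)
  ultimately show ?thesis
    unfolding pair_sum_def sum_lessThan_4 by (simp add: pair_type_def algebra_simps)
qed

section \<open>Invariance under permutations of the three pairs\<close>

lemma pair_sum_permute:
  assumes "\<sigma> permutes {..<3}"
  shows "pair_sum (\<lambda>p q. h (\<sigma> p) (\<sigma> q)) (\<nu> \<circ> \<sigma>) = pair_sum h \<nu>"
proof -
  have \<sigma>: "\<sigma> permutes {..<4}" using assms by (rule permutes_subset) auto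
  have "pair_sum h \<nu> = (\<Sum>p<4. \<Sum>q<4. h (\<sigma> p) (\<sigma> q) * (\<nu> (\<sigma> p) * (\<nu> (\<sigma> q) - of_bool (\<sigma> p = \<sigma> q))))"
    unfolding pair_sum_def by (subst sum.permute[OF \<sigma>], rule sum.cong[OF refl], subst sum.permute[OF \<sigma>]) simp
  then show ?thesis
    using permutes_inj[OF \<sigma>] by (simp add: pair_sum_def inj_eq)
qed

text \<open>Such a permutation fixes class 3 and preserves \<open>gram\<close>,
  \<open>pair_type\<close> and \<open>class_sizes\<close>, hence every sum built from them.\<close>

lemma mult_sum_permute:
  assumes "\<sigma> permutes {..<3}"
  shows "mult_sum s t v (remove_pair (class_sizes m) (\<sigma> p) (\<sigma> q)) =
    mult_sum s t v (remove_pair (class_sizes m) p q)"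
proof -
  have 3: "\<sigma> r = 3 \<longleftrightarrow> r = 3" for r
    using permutes_not_in[OF assms, of 3] permutes_inj[OF assms] by (metis inj_eq lessThan_iff less_irrefl)
  have inj: "\<sigma> x = \<sigma> y \<longleftrightarrow> x = y" for x y
    using permutes_inj[OF assms] by (simp add: inj_eq)
  have remove: "remove_pair \<nu> (\<sigma> x) (\<sigma> y) \<circ> \<sigma> = remove_pair (\<nu> \<circ> \<sigma>) x y" for \<nu> x y
    by (simp add: remove_pair_def fun_eq_iff inj)
  have gram_\<sigma>: "gram s t (\<sigma> x) (\<sigma> y) = gram s t x y" for x y
    by (simp add: gram_def 3 inj)
  have gram: "pair_sum (gram s t) (\<nu> \<circ> \<sigma>) = pair_sum (gram s t) \<nu>" for \<nu>
    using pair_sum_permute[OF assms, of "gram s t" \<nu>] by (simp add: gram_\<sigma>)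
  have mult: "mult_sum s t v (\<nu> \<circ> \<sigma>) = mult_sum s t v \<nu>" for \<nu>
  proof -
    have "pair_sum (gram s t) (remove_pair (\<nu> \<circ> \<sigma>) p q) = pair_sum (gram s t) (remove_pair \<nu> (\<sigma> p) (\<sigma> q))"
      for p q by (simp only: remove[symmetric] gram)
    moreover have "pair_type p q = pair_type (\<sigma> p) (\<sigma> q)" for p q
      by (simp add: pair_type_def 3 inj)
    ultimately show ?thesis
      unfolding mult_sum_def
      by (subst pair_sum_permute[OF assms, symmetric]) simp
  qed
  have "class_sizes m \<circ> \<sigma> = class_sizes m"
    using permutes_in_image[OF assms] by (simp add: class_sizes_def fun_eq_iff 3)
  then show ?thesis
    by (metis mult remove)
qed

text \<open>Transpositions of the classes 0, 1, 2 and the symmetry in \<open>p\<close> and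
  \<open>q\<close> carry every pair to the representative of its type.\<close>

lemma mult_sum_row_class:
  assumes "p < 4" "q < 4"
  shows "mult_sum s t v (remove_pair (class_sizes m) p q) =
    mult_sum s t v (remove_pair (class_sizes m) (fst (row_class (pair_type p q)))
      (snd (row_class (pair_type p q))))"
proof -
  define f where "f = (\<lambda>p q. mult_sum s t v (remove_pair (class_sizes m) p q))"
  have commute: "f q p = f p q" for p q by (simp add: f_def remove_pair_commute)
  have transpose: "f (transpose i j p) (transpose i j q) = f p q" if "i < 3" "j < 3" for i j p q
    unfolding f_def using that by (intro mult_sum_permute permutes_swap_id) auto
  have "f 1 1 = f 0 0" "f 2 2 = f 0 0" "f 1 3 = f 0 3" "f 2 3 = f 0 3" "f 0 2 = f 0 1" "f 2 1 = f 0 1"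
    using transpose[of 0 1 0 0] transpose[of 0 2 0 0] transpose[of 0 1 0 3] transpose[of 0 2 0 3]
      transpose[of 1 2 0 1] transpose[of 0 2 0 1] by (simp_all add: transpose_def)
  moreover have "p = 0 \<or> p = 1 \<or> p = 2 \<or> p = 3" "q = 0 \<or> q = 1 \<or> q = 2 \<or> q = 3" using assms by auto
  ultimately have "f p q = f (fst (row_class (pair_type p q))) (snd (row_class (pair_type p q)))"
    using commute[of 0 1] commute[of 0 2] commute[of 1 2] commute[of 0 3] commute[of 1 3] commute[of 2 3]
    by (elim disjE) (simp_all add: pair_type_def row_class_def)
  then show ?thesis by (simp only: f_def)
qed

text \<open>Expanding \<open>v\<close> in the indicator functions of the four types exhibits
  \<open>mult_sum\<close> as a matrix row applied to \<open>v\<close>.\<close>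

lemma mult_sum_linear:
  "mult_sum s t v \<nu> = (\<Sum>j<4. mult_sum s t (\<lambda>l. of_bool (l = j)) \<nu> * v j)"
proof -
  have *: "v (pair_type p q) = (\<Sum>j<4. of_bool (pair_type p q = j) * v j)" for p q
    unfolding sum_lessThan_4 by (simp add: pair_type_def)
  have "mult_sum s t v \<nu> = (\<Sum>p<4. \<Sum>q<4. \<Sum>j<4. of_bool (pair_type p q = j)
      * pair_sum (gram s t) (remove_pair \<nu> p q) * (\<nu> p * (\<nu> q - of_bool (p = q))) * v j)"
    unfolding mult_sum_def pair_sum_def[of "\<lambda>p q. v (pair_type p q) * _ p q"]
    by (subst *) (simp only: sum_distrib_left sum_distrib_right mult_ac)
  also have "\<dots> = (\<Sum>p<4. \<Sum>j<4. \<Sum>q<4. of_bool (pair_type p q = j)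
      * pair_sum (gram s t) (remove_pair \<nu> p q) * (\<nu> p * (\<nu> q - of_bool (p = q))) * v j)"
    by (intro sum.cong refl sum.swap)
  also have "\<dots> = (\<Sum>j<4. \<Sum>p<4. \<Sum>q<4. of_bool (pair_type p q = j)
      * pair_sum (gram s t) (remove_pair \<nu> p q) * (\<nu> p * (\<nu> q - of_bool (p = q))) * v j)"
    by (rule sum.swap)
  also have "\<dots> = (\<Sum>j<4. mult_sum s t (\<lambda>l. of_bool (l = j)) \<nu> * v j)"
    unfolding mult_sum_def pair_sum_def[of "\<lambda>p q. of_bool (pair_type p q = _) * _ p q"]
    by (simp only: sum_distrib_right)
  finally show ?thesis .
qed

lemma continuous_on_mult_sum [continuous_intros]:
  assumes "continuous_on S f" "continuous_on S g"
  shows "continuous_on S (\<lambda>x. mult_sum (f x) (g x) v \<nu>)"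
  unfolding mult_sum_expand pair_sum_gram gram_sum_def
  by (intro continuous_intros assms)

lemma mult_mat_carrier [simp]: "mult_mat m s t \<in> carrier_mat 4 4"
  by (simp add: mult_mat_def)

lemma continuous_on_det_mult_mat:
  assumes "continuous_on S f" "continuous_on S g"
  shows "continuous_on S (\<lambda>x. det (mult_mat m (f x) (g x)))"
proof -
  have "continuous_on S (\<lambda>x. mult_mat m (f x) (g x) $$ (i, j))" if "i < 4" "j < 4" for i j
    using that by (cases "i \<le> m + 1") (auto simp: mult_mat_def intro!: continuous_intros assms)
  then show ?thesis
    unfolding det_def'[OF mult_mat_carrier]
    by (intro continuous_intros) (auto simp: permutes_in_image)
qed

section \<open>Small determinants and the sign change at s = 0\<close>

lemma det_2x2:
  fixes A :: "'a::comm_ring_1 mat"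
  assumes "A \<in> carrier_mat 2 2"
  shows "det A = A $$ (0,0) * A $$ (1,1) - A $$ (0,1) * A $$ (1,0)"
  using assms
  by (subst laplace_expansion_row[of _ 2 0])
    (auto simp: numeral_2_eq_2 cofactor_def mat_delete_def det_single)

lemma det_3x3:
  fixes A :: "'a::comm_ring_1 mat"
  assumes "A \<in> carrier_mat 3 3"
  shows "det A = A $$ (0,0) * (A $$ (1,1) * A $$ (2,2) - A $$ (1,2) * A $$ (2,1))
     - A $$ (0,1) * (A $$ (1,0) * A $$ (2,2) - A $$ (1,2) * A $$ (2,0))
     + A $$ (0,2) * (A $$ (1,0) * A $$ (2,1) - A $$ (1,1) * A $$ (2,0))"
  using assms
  by (subst laplace_expansion_row[of _ 3 0])
    (auto simp: eval_nat_numeral cofactor_def mat_delete_def det_2x2 algebra_simps)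

lemma det_4x4:
  fixes A :: "'a::comm_ring_1 mat"
  assumes "A \<in> carrier_mat 4 4"
  shows "det A = 
       A $$ (0,0) * (A $$ (1,1) * (A $$ (2,2) * A $$ (3,3) - A $$ (2,3) * A $$ (3,2))
          - A $$ (1,2) * (A $$ (2,1) * A $$ (3,3) - A $$ (2,3) * A $$ (3,1))
          + A $$ (1,3) * (A $$ (2,1) * A $$ (3,2) - A $$ (2,2) * A $$ (3,1)))
     - A $$ (0,1) * (A $$ (1,0) * (A $$ (2,2) * A $$ (3,3) - A $$ (2,3) * A $$ (3,2))
          - A $$ (1,2) * (A $$ (2,0) * A $$ (3,3) - A $$ (2,3) * A $$ (3,0))
          + A $$ (1,3) * (A $$ (2,0) * A $$ (3,2) - A $$ (2,2) * A $$ (3,0)))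
     + A $$ (0,2) * (A $$ (1,0) * (A $$ (2,1) * A $$ (3,3) - A $$ (2,3) * A $$ (3,1))
          - A $$ (1,1) * (A $$ (2,0) * A $$ (3,3) - A $$ (2,3) * A $$ (3,0))
          + A $$ (1,3) * (A $$ (2,0) * A $$ (3,1) - A $$ (2,1) * A $$ (3,0)))
     - A $$ (0,3) * (A $$ (1,0) * (A $$ (2,1) * A $$ (3,2) - A $$ (2,2) * A $$ (3,1))
          - A $$ (1,1) * (A $$ (2,0) * A $$ (3,2) - A $$ (2,2) * A $$ (3,0))
          + A $$ (1,2) * (A $$ (2,0) * A $$ (3,1) - A $$ (2,1) * A $$ (3,0)))"
  using assms
  by (subst laplace_expansion_row[of _ 4 0])
    (auto simp: eval_nat_numeral cofactor_def mat_delete_def det_3x3 algebra_simps)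

lemma mult_sum_0:
  "mult_sum 0 t v (remove_pair (class_sizes m) 0 0) =
     (8 - 8 * t) * v 0 + (16 + 8 * t) * v 1 + 48 * real m * v 2 + 12 * real m * (real m - 1) * v 3"
  "mult_sum 0 t v (remove_pair (class_sizes m) 0 (Suc 0)) =
     (4 + 2 * t) * v 0 + (20 + 4 * t) * v 1 + real m * (48 + 12 * t) * v 2
     + real m * (real m - 1) * (12 + 3 * t) * v 3"
  "mult_sum 0 t v (remove_pair (class_sizes m) 0 3) =
     24 * v 0 + (96 + 24 * t) * v 1 + (real m - 1) * (120 + 24 * t) * v 2
     + (real m - 1) * (real m - 2) * (20 + 4 * t) * v 3"
  "mult_sum 0 t v (remove_pair (class_sizes m) 3 3) =
     72 * v 0 + (288 + 72 * t) * v 1 + (real m - 2) * (240 + 48 * t) * v 2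
     + (real m - 2) * (real m - 3) * (30 + 6 * t) * v 3"
  unfolding mult_sum_expand pair_sum_gram
  by (simp_all add: pair_type_def remove_pair_def class_sizes_def)
     (simp_all add: gram_sum_def algebra_simps)

text \<open>The deciding factor \<open>t\<^sup>2 + 4 * t - 2\<close> is \<open>-2\<close> at
  \<open>t = 0\<close> and \<open>1 / 4\<close> at \<open>t = 1 / 2\<close>. The sign of its
  cofactor differs between \<open>m = 0\<close> and \<open>m > 0\<close>, which is why the claim
  concerns the product.\<close>

lemma det_mult_mat_neg:
  "det (mult_mat m 0 0) * det (mult_mat m 0 (1 / 2)) < 0"
proof -
  consider "m = 0" | "m = 1" | "m \<ge> 2" by linarith
  then show ?thesis
  proof cases
    case 3
    have "det (mult_mat m 0 0) = - 115200 * ((real m + 1)\<^sup>2 * (real m + 2))"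
      using 3 unfolding det_4x4[OF mult_mat_carrier]
      by (simp add: mult_mat_def row_class_def mult_sum_0) (simp add: algebra_simps power2_eq_square)
    moreover have "det (mult_mat m 0 (1 / 2)) = 17424 * ((real m + 1)\<^sup>2 * (real m + 2))"
      using 3 unfolding det_4x4[OF mult_mat_carrier]
      by (simp add: mult_mat_def row_class_def mult_sum_0) (simp add: algebra_simps power2_eq_square)
    moreover have "(real m + 1)\<^sup>2 * (real m + 2) > 0" by simp
    ultimately show ?thesis by (simp add: mult_neg_pos)
  qed (unfold det_4x4[OF mult_mat_carrier], simp_all add: mult_mat_def row_class_def mult_sum_0)
qed

text \<open>By continuity in \<open>s\<close> the two determinants keep opposite signs for some
  \<open>s > 0\<close>; the intermediate value theorem in \<open>t\<close> then gives a singular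
  matrix.\<close>

lemma ex_mult_mat_kernel:
  obtains s t v where "0 < s" "0 \<le> t" "t < 1"
    "v \<in> carrier_vec 4" "v \<noteq> 0\<^sub>v 4" "mult_mat m s t *\<^sub>v v = 0\<^sub>v 4"
proof -
  define \<Delta> where "\<Delta> = (\<lambda>s t. det (mult_mat m s t))"
  have "isCont (\<lambda>s. \<Delta> s 0 * \<Delta> s (1 / 2)) 0"
    using continuous_on_det_mult_mat[of UNIV "\<lambda>x. x" "\<lambda>x. _" m] unfolding \<Delta>_def
    by (intro continuous_intros) (simp_all add: continuous_on_eq_continuous_at)
  then have "((\<lambda>s. \<Delta> s 0 * \<Delta> s (1 / 2)) \<longlongrightarrow> \<Delta> 0 0 * \<Delta> 0 (1 / 2)) (at_right 0)"
    unfolding isCont_def by (rule tendsto_within_subset) simp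
  moreover have "\<Delta> 0 0 * \<Delta> 0 (1 / 2) < 0"
    unfolding \<Delta>_def by (rule det_mult_mat_neg)
  ultimately have "\<forall>\<^sub>F s in at_right 0. 0 < s \<and> \<Delta> s 0 * \<Delta> s (1 / 2) < 0"
    by (intro eventually_conj eventually_at_right_less order_tendstoD(2))
  then obtain s where s: "s > 0" "\<Delta> s 0 * \<Delta> s (1 / 2) < 0"
    using eventually_happens'[OF trivial_limit_at_right_real] by blast
  have "\<exists>t\<in>{0..1/2}. \<Delta> s t = 0"
  proof -
    have "connected (\<Delta> s ` {0..1/2})"
      unfolding \<Delta>_def by (intro connected_continuous_image continuous_on_det_mult_mat continuous_intros) auto
    moreover have "\<Delta> s 0 \<in> \<Delta> s ` {0..1/2}" "\<Delta> s (1 / 2) \<in> \<Delta> s ` {0..1/2}" by auto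
    ultimately have "0 \<in> \<Delta> s ` {0..1/2}"
      using s(2) unfolding mult_less_0_iff by (elim disjE conjE) (blast intro: connectedD_interval less_imp_le)+
    then show ?thesis by auto
  qed
  then obtain t where "0 \<le> t" "t < 1" "det (mult_mat m s t) = 0" by (auto simp: \<Delta>_def)
  then show ?thesis
    using that s(1) det_0_iff_vec_prod_zero[OF mult_mat_carrier] by metis
qed

text \<open>A kernel vector provides the weights \<open>v\<close>. The bound on \<open>i\<close>
  says that a nonzero weight belongs to a type that really occurs, so the form built from
  \<open>v\<close> will not vanish.\<close>

lemma ex_mult_sum_zero:
  obtains s t v i where "0 < s" "0 \<le> t" "t < 1" "i < 4" "i \<le> m + 1" "v i \<noteq> (0::real)"
    "\<And>p q. p < 4 \<Longrightarrow> q < 4 \<Longrightarrow> pair_type p q \<le> m + 1 \<Longrightarrow>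
       mult_sum s t v (remove_pair (class_sizes m) p q) = 0"
proof -
  obtain s t w where st: "0 < s" "0 \<le> t" "t < 1" and w: "w \<in> carrier_vec 4" "w \<noteq> 0\<^sub>v 4"
    and ker: "mult_mat m s t *\<^sub>v w = 0\<^sub>v 4"
    by (rule ex_mult_mat_kernel)
  have row: "(\<Sum>j<4. mult_mat m s t $$ (i, j) * w $ j) = 0" if "i < 4" for i
    using arg_cong[OF ker, of "\<lambda>u. u $ i"] that w(1)
    by (simp add: mult_mat_vec_def scalar_prod_def lessThan_atLeast0) (simp add: mult_mat_def)
  have big: "w $ i = 0" if "i < 4" "\<not> i \<le> m + 1" for i
    using row[OF that(1)] that by (simp add: mult_mat_def if_distrib cong: if_cong)
  obtain i where i: "i < 4" "w $ i \<noteq> 0"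
    using w by (metis carrier_vecD eq_vecI index_zero_vec zero_carrier_vec)
  show ?thesis
  proof (rule that[where v = "($) w", OF st i(1) _ i(2)])
    show "i \<le> m + 1" using big i by blast
    fix p q :: nat
    assume pq: "p < 4" "q < 4" "pair_type p q \<le> m + 1"
    have "pair_type p q < 4" by (simp add: pair_type_def)
    then show "mult_sum s t (($) w) (remove_pair (class_sizes m) p q) = 0"
      using row[of "pair_type p q"] pq(3)
      by (subst mult_sum_row_class[OF pq(1,2)], subst mult_sum_linear) (simp add: mult_mat_def)
  qed
qed

subsection \<open>Forms diagonal in the standard coordinates\<close>

text \<open>
  The scalar factor is chosen so that \<open>diag_form f\<close> is \<open>\<Sum>\<^sub>S f S \<cdot> V\<^sub>S\<close> with \<open>V\<^sub>S\<close> the product of the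
  \<open>V\<^sub>j = (\<i> / 2) dx\<^sub>j \<and> dx\<^sup>*\<^sub>j\<close>, \<open>j \<in> S\<close>.
\<close>

definition diag_form :: "(nat set \<Rightarrow> complex) \<Rightarrow> form" where
  "diag_form f = (\<lambda>I J. if I = J \<and> finite I then (\<i> / 2) ^ card I * (-1) ^ (card I choose 2) * f I else 0)"

text \<open>Multiplication in the algebra generated by the commuting \<open>V_j\<close> of square
  zero: \<open>V_A V_B\<close> is \<open>V_(A \<union> B)\<close> for disjoint \<open>A\<close> and
  \<open>B\<close>, and 0 otherwise.\<close>

definition subset_conv :: "(nat set \<Rightarrow> complex) \<Rightarrow> (nat set \<Rightarrow> complex) \<Rightarrow> nat set \<Rightarrow> complex" where
  "subset_conv f g S = (\<Sum>A\<in>Pow S. f A * g (S - A))"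

lemma shuffle_sign_square [simp]: "shuffle_sign A B * shuffle_sign A B = 1"
  by (simp add: shuffle_sign_def power_mult_distrib[symmetric])

lemma choose_2_add: "(a + b choose 2) = (a choose 2) + (b choose 2) + a * b" for a b :: nat
  by (induction a) (simp_all add: numeral_2_eq_2)

text \<open>The two shuffle signs coincide and cancel. The sign from moving conjugate differentials
  is absorbed by the normalising exponents through \<open>choose_2_add\<close>.\<close>

lemma wedge_diag_form: "wedge (diag_form f) (diag_form g) = diag_form (subset_conv f g)"
proof (intro ext)
  fix I J :: "nat set"
  let ?t = "\<lambda>A B. (-1) ^ (card B * card (I - A)) * shuffle_sign A (I - A) * shuffle_sign B (J - B)
       * diag_form f A B * diag_form g (I - A) (J - B)"
  have eq: "wedge (diag_form f) (diag_form g) I J = (\<Sum>A\<in>Pow I. \<Sum>B\<in>Pow J. ?t A B)"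
    by (simp add: wedge_def)
  show "wedge (diag_form f) (diag_form g) I J = diag_form (subset_conv f g) I J"
  proof (cases "I = J \<and> finite I")
    case False
    have "?t A B = 0" if "A \<subseteq> I" "B \<subseteq> J" for A B
    proof (rule ccontr)
      assume "?t A B \<noteq> 0"
      then have "A = B" "I - A = J - B" "finite A" "finite (I - A)"
        by (auto simp: diag_form_def split: if_splits)
      then show False using False that by (metis Diff_partition finite_Diff2)
    qed
    then show ?thesis using False unfolding eq by (auto simp: diag_form_def intro!: sum.neutral)
  next
    case True
    then have fin: "finite I" and J: "J = I" by auto
    have "(\<Sum>B\<in>Pow J. ?t A B) = (\<i> / 2) ^ card I * (-1) ^ (card I choose 2) * (f A * g (I - A))" if A: "A \<subseteq> I" for A
    proof -
      have "(\<Sum>B\<in>Pow J. ?t A B) = (\<Sum>B\<in>{A}. ?t A B)"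
        using A fin J by (intro sum.mono_neutral_right) (auto simp: diag_form_def)
      also have "\<dots> = (-1) ^ (card A * card (I - A)) * diag_form f A A * diag_form g (I - A) (I - A)"
        using J by (simp add: mult.assoc)
      also have "\<dots> = (\<i> / 2) ^ (card A + card (I - A))
          * ((-1) ^ ((card A choose 2) + (card (I - A) choose 2) + card A * card (I - A))) * (f A * g (I - A))"
        using A fin by (simp add: diag_form_def finite_subset power_add mult_ac)
      also have "card A + card (I - A) = card I"
        using A fin by (metis card_Diff_subset card_mono finite_subset le_add_diff_inverse)
      finally show ?thesis
        using choose_2_add[of "card A" "card (I - A)"] \<open>card A + card (I - A) = card I\<close> by simp
    qed
    then show ?thesis
      unfolding eq using fin J
      by (simp add: diag_form_def subset_conv_def sum_distrib_left)
  qed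
qed

definition singleton_fun :: "nat \<Rightarrow> (nat \<Rightarrow> complex) \<Rightarrow> nat set \<Rightarrow> complex" where
  "singleton_fun n w S = (\<Sum>j<n. if S = {j} then w j else 0)"

text \<open>While \<open>singleton_fun n w\<close> holds the coefficients of a linear form in the
  \<open>V_j\<close>, this holds those of a product of such linear forms.\<close>

definition conv_prod :: "nat \<Rightarrow> (nat \<Rightarrow> complex) list \<Rightarrow> nat set \<Rightarrow> complex" where
  "conv_prod n ws = foldr (\<lambda>w. subset_conv (singleton_fun n w)) ws (\<lambda>S. of_bool (S = {}))"

lemma wedge_list_diag_form:
  "wedge_list (map (\<lambda>w. diag_form (singleton_fun n w)) ws) = diag_form (conv_prod n ws)"
proof (induction ws)
  case Nil
  show ?case by (auto simp: wedge_list_def conv_prod_def form_one_def diag_form_def fun_eq_iff numeral_2_eq_2)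
next
  case (Cons w ws)
  then show ?case by (simp add: wedge_list_def conv_prod_def wedge_diag_form)
qed

text \<open>The first factor uses up one index \<open>j\<close> of \<open>S\<close>, and the
  remaining factors must fill \<open>S - {j}\<close>.\<close>

lemma conv_prod_Cons:
  assumes "S \<subseteq> {..<n}"
  shows "conv_prod n (w # ws) S = (\<Sum>j\<in>S. w j * conv_prod n ws (S - {j}))"
proof -
  have fin: "finite S" using assms by (rule finite_subset) simp
  have "conv_prod n (w # ws) S = (\<Sum>A\<in>Pow S. singleton_fun n w A * conv_prod n ws (S - A))"
    by (simp add: conv_prod_def subset_conv_def)
  also have "\<dots> = (\<Sum>A\<in>(\<lambda>j. {j}) ` S. singleton_fun n w A * conv_prod n ws (S - A))"
  proof (rule sum.mono_neutral_right)
    show "\<forall>A\<in>Pow S - (\<lambda>j. {j}) ` S. singleton_fun n w A * conv_prod n ws (S - A) = 0"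
    proof
      fix A assume "A \<in> Pow S - (\<lambda>j. {j}) ` S"
      then have "A \<noteq> {j}" for j by auto
      then show "singleton_fun n w A * conv_prod n ws (S - A) = 0" by (simp add: singleton_fun_def)
    qed
  qed (use fin in auto)
  also have "\<dots> = (\<Sum>j\<in>S. singleton_fun n w {j} * conv_prod n ws (S - {j}))"
    by (subst sum.reindex) (auto simp: inj_on_def)
  also have "\<dots> = (\<Sum>j\<in>S. w j * conv_prod n ws (S - {j}))"
    using assms by (intro sum.cong refl) (auto simp: singleton_fun_def)
  finally show ?thesis .
qed

text \<open>Since the \<open>V_j\<close> have square zero, the \<open>m\<close>-th power of their
  sum is \<open>m!\<close> times the elementary symmetric polynomial of degree
  \<open>m\<close>.\<close>

lemma conv_prod_replicate_1:
  assumes "S \<subseteq> {..<n}"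
  shows "conv_prod n (replicate m (\<lambda>_. 1)) S = fact m * of_bool (card S = m)"
  using assms
proof (induction m arbitrary: S)
  case 0
  then have "finite S" using finite_subset by blast
  then show ?case by (auto simp: conv_prod_def)
next
  case (Suc m)
  then have fin: "finite S" using finite_subset by blast
  have "conv_prod n (replicate (Suc m) (\<lambda>_. 1)) S
      = (\<Sum>j\<in>S. conv_prod n (replicate m (\<lambda>_. 1)) (S - {j}))"
    using Suc.prems by (simp add: conv_prod_Cons)
  also have "\<dots> = (\<Sum>j\<in>S. fact m * of_bool (card S = Suc m))"
  proof (rule sum.cong[OF refl])
    fix j assume "j \<in> S"
    then have "card S = Suc (card (S - {j}))" using fin by (metis card_Suc_Diff1)
    moreover have "S - {j} \<subseteq> {..<n}" using Suc.prems by auto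
    ultimately show "conv_prod n (replicate m (\<lambda>_. 1)) (S - {j}) = fact m * of_bool (card S = Suc m)"
      by (simp add: Suc.IH)
  qed
  finally show ?case by (auto simp: mult_ac)
qed

text \<open>The first two factors choose distinct indices; the other \<open>m\<close> factors fill
  the rest of \<open>S\<close> in \<open>m!\<close> ways.\<close>

lemma conv_prod_Cons2_replicate_1:
  assumes "S \<subseteq> {..<n}" "card S = m + 2"
  shows "conv_prod n (u # w # replicate m (\<lambda>_. 1)) S = fact m * (\<Sum>i\<in>S. \<Sum>j\<in>S - {i}. u i * w j)"
proof -
  have fin: "finite S" using assms(1) finite_subset by blast
  have "conv_prod n (u # w # replicate m (\<lambda>_. 1)) S
      = (\<Sum>i\<in>S. u i * (\<Sum>j\<in>S - {i}. w j * conv_prod n (replicate m (\<lambda>_. 1)) (S - {i} - {j})))"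
    using assms(1) by (subst conv_prod_Cons, simp, intro sum.cong refl, subst conv_prod_Cons) auto
  also have "\<dots> = (\<Sum>i\<in>S. u i * (\<Sum>j\<in>S - {i}. w j * fact m))"
  proof (intro sum.cong arg_cong2[where f = "(*)"] refl)
    fix i j assume "i \<in> S" "j \<in> S - {i}"
    then have "card (S - {i} - {j}) = m" using fin assms(2) by simp
    moreover have "S - {i} - {j} \<subseteq> {..<n}" using assms(1) by auto
    ultimately show "conv_prod n (replicate m (\<lambda>_. 1)) (S - {i} - {j}) = fact m"
      by (simp add: conv_prod_replicate_1)
  qed
  also have "\<dots> = fact m * (\<Sum>i\<in>S. \<Sum>j\<in>S - {i}. u i * w j)"
    by (simp add: sum_distrib_left mult_ac)
  finally show ?thesis .
qed

lemma conv_prod_zero: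
  assumes "w \<in> set ws" "\<And>j. w j = 0"
  shows "conv_prod n ws S = 0"
  using assms(1)
proof (induction ws arbitrary: S)
  case (Cons x xs)
  have "singleton_fun n w A = 0" for A using assms(2) by (simp add: singleton_fun_def)
  with Cons show ?case by (auto simp: conv_prod_def subset_conv_def)
qed simp

section \<open>Wedging a form supported on pairs with a diagonal form\<close>

lemma shuffle_sign_Un_left:
  assumes "finite A" "finite Q" "finite B" "A \<inter> Q = {}" "\<And>q b. q \<in> Q \<Longrightarrow> b \<in> B \<Longrightarrow> b < q"
  shows "shuffle_sign (A \<union> Q) B = shuffle_sign A B * (-1) ^ (card Q * card B)"
proof -
  have "{(a, b). a \<in> A \<union> Q \<and> b \<in> B \<and> b < a} = {(a, b). a \<in> A \<and> b \<in> B \<and> b < a} \<union> Q \<times> B"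
    using assms(5) by auto
  moreover have "finite {(a, b). a \<in> A \<and> b \<in> B \<and> b < a}"
    using assms(1,3) by (intro finite_subset[OF _ finite_cartesian_product[of A B]]) auto
  moreover have "{(a, b). a \<in> A \<and> b \<in> B \<and> b < a} \<inter> Q \<times> B = {}" using assms(4) by auto
  ultimately have "card {(a, b). a \<in> A \<union> Q \<and> b \<in> B \<and> b < a}
      = card {(a, b). a \<in> A \<and> b \<in> B \<and> b < a} + card Q * card B"
    using assms(2,3) by (simp add: card_Un_disjoint card_cartesian_product)
  then show ?thesis by (simp add: shuffle_sign_def power_add)
qed

text \<open>With \<open>Q = {N..<n}\<close>, this is a combination of forms with
  \<open>I = A\<close> and \<open>J = A \<union> Q\<close> for pairs \<open>A\<close>. The conjugate
  differentials of \<open>Q\<close> annihilate every \<open>V_j\<close> with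
  \<open>j \<in> Q\<close>, which reduces the computation to \<open>N\<close> variables.\<close>

definition pair_form :: "nat \<Rightarrow> nat \<Rightarrow> (nat set \<Rightarrow> real) \<Rightarrow> form" where
  "pair_form n N a = (\<lambda>I J. if I \<subseteq> {..<N} \<and> card I = 2 \<and> J = I \<union> {N..<n} then of_real (a I) else 0)"

lemma pair_form_in_forms:
  assumes "N \<le> n"
  shows "pair_form n N a \<in> forms n 2 (n - N + 2)"
proof -
  have "card (I \<union> {N..<n}) = n - N + 2" if "I \<subseteq> {..<N}" "card I = 2" for I
  proof -
    have "finite I" using that(1) finite_subset by blast
    then show ?thesis using that by (subst card_Un_disjoint) auto
  qed
  then show ?thesis using assms unfolding forms_def pair_form_def by auto
qed

text \<open>Only components at \<open>(I, I \<union> Q)\<close> with \<open>I\<close> below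
  \<open>N\<close> and of size \<open>k + 2\<close> can survive, and their coefficients are constant
  multiples of the sums assumed to vanish.\<close>

lemma wedge_pair_form_eq_0:
  fixes a :: "nat set \<Rightarrow> real" and f :: "nat set \<Rightarrow> complex"
  assumes supp: "\<And>S. f S \<noteq> 0 \<Longrightarrow> S \<subseteq> {..<n} \<and> card S = k"
    and zero: "\<And>I. I \<subseteq> {..<N} \<Longrightarrow> card I = k + 2 \<Longrightarrow>
      (\<Sum>A | A \<subseteq> I \<and> card A = 2. of_real (a A) * f (I - A)) = 0"
  shows "wedge (pair_form n N a) (diag_form f) = (\<lambda>I J. 0)"
proof (intro ext)
  fix I J :: "nat set"
  let ?Q = "{N..<n}"
  let ?t = "\<lambda>A B. (-1) ^ (card B * card (I - A)) * shuffle_sign A (I - A) * shuffle_sign B (J - B)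
       * pair_form n N a A B * diag_form f (I - A) (J - B)"
  have nz: "A \<subseteq> {..<N} \<and> card A = 2 \<and> B = A \<union> ?Q \<and> I - A = J - B \<and> I - A \<subseteq> {..<n} \<and> card (I - A) = k"
    if "?t A B \<noteq> 0" for A B
    using that supp[of "I - A"] by (auto simp: pair_form_def diag_form_def split: if_splits)
  have eq: "wedge (pair_form n N a) (diag_form f) I J = (\<Sum>A\<in>Pow I. \<Sum>B\<in>Pow J. ?t A B)"
    by (simp add: wedge_def)
  show "wedge (pair_form n N a) (diag_form f) I J = 0"
  proof (cases "I \<subseteq> {..<N} \<and> J = I \<union> ?Q \<and> card I = k + 2")
    case False
    have "?t A B = 0" if AB: "A \<in> Pow I" "B \<in> Pow J" for A B
    proof (rule ccontr)
      assume "?t A B \<noteq> 0"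
      note * = nz[OF this]
      have "finite A" "finite (I - A)" using * finite_subset by blast+
      then have "card I = k + 2" using * AB
        by (metis Diff_disjoint Diff_partition PowD add.commute card_Un_disjoint)
      \<comment> \<open>The set \<open>I - A = J - B\<close> avoids \<open>B\<close>, which contains
        all indices from \<open>N\<close> to \<open>n - 1\<close>.\<close>
      moreover have "I - A \<subseteq> {..<N}"
      proof
        fix x assume "x \<in> I - A"
        then have "x < n" "x \<notin> B" using * by auto
        then show "x \<in> {..<N}" using * by auto
      qed
      then have "I \<subseteq> {..<N}" using * by auto
      moreover have "J = I \<union> ?Q" using * AB by auto
      ultimately show False using False by blast
    qed
    then show ?thesis unfolding eq by (simp add: sum.neutral)
  next
    case True
    then have fin: "finite I" "finite J" using finite_subset by (blast, auto intro: finite_subset)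
    \<comment> \<open>The factor in front does not depend on \<open>A\<close>, so it can be taken
      out of the sum over \<open>A\<close>.\<close>
    have "(\<Sum>B\<in>Pow J. ?t A B) = (\<i> / 2) ^ k * (-1) ^ (k choose 2) * (if card A = 2 then of_real (a A) * f (I - A) else 0)"
      if A: "A \<subseteq> I" for A
    proof (cases "card A = 2")
      case False
      then show ?thesis by (simp add: pair_form_def)
    next
      case A2: True
      have disj: "A \<inter> ?Q = {}" "I \<inter> ?Q = {}" using A True by auto
      have AN: "A \<subseteq> {..<N}" using A True by auto
      have finA: "finite A" using A fin finite_subset by blast
      have k: "card (I - A) = k" using A A2 True finA by (simp add: card_Diff_subset)
      have JA: "J - (A \<union> ?Q) = I - A" using True disj by auto
      have cardA: "card (A \<union> ?Q) = 2 + card ?Q" using disj finA A2 by (subst card_Un_disjoint) auto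
      have "(\<Sum>B\<in>Pow J. ?t A B) = (\<Sum>B\<in>{A \<union> ?Q}. ?t A B)"
        using A fin True by (intro sum.mono_neutral_right) (auto simp: pair_form_def)
      also have "\<dots> = (-1) ^ ((2 + card ?Q) * k) * shuffle_sign A (I - A) * shuffle_sign (A \<union> ?Q) (I - A)
          * of_real (a A) * diag_form f (I - A) (I - A)"
        using A2 AN by (simp add: JA cardA k pair_form_def del: card_atLeastLessThan)
      also have "shuffle_sign (A \<union> ?Q) (I - A) = shuffle_sign A (I - A) * (-1) ^ (card ?Q * k)"
        using finA fin True disj unfolding k[symmetric] by (intro shuffle_sign_Un_left) auto
      \<comment> \<open>The sign due to \<open>Q\<close> arises once from moving conjugate
        differentials and once from the shuffle, so it cancels like the sign of \<open>A\<close>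
        against \<open>I - A\<close>.\<close>
      also have "(-1) ^ ((2 + card ?Q) * k) * shuffle_sign A (I - A) * (shuffle_sign A (I - A) * (-1) ^ (card ?Q * k))
        = (shuffle_sign A (I - A) * shuffle_sign A (I - A)) * ((-1) ^ (card ?Q * k) * (-1) ^ (card ?Q * k))"
        by (simp add: algebra_simps power_add power_mult)
      also have "\<dots> = 1" by (simp add: power_add[symmetric])
      finally show ?thesis using A2 fin by (simp add: diag_form_def k mult_ac)
    qed
    then have "wedge (pair_form n N a) (diag_form f) I J = (\<Sum>A\<in>Pow I. (\<i> / 2) ^ k * (-1) ^ (k choose 2)
        * (if card A = 2 then of_real (a A) * f (I - A) else 0))"
      unfolding eq by (intro sum.cong) auto
    also have "\<dots> = (\<i> / 2) ^ k * (-1) ^ (k choose 2) * (\<Sum>A | A \<subseteq> I \<and> card A = 2. of_real (a A) * f (I - A))"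
      using fin by (simp only: sum_distrib_left[symmetric])
        (simp add: sum.inter_filter[symmetric] Pow_def Collect_conj_eq[symmetric])
    finally show ?thesis using zero True by simp
  qed
qed

lemma conv_prod_support:
  "conv_prod n ws S \<noteq> 0 \<Longrightarrow> S \<subseteq> {..<n} \<and> card S = length ws"
proof (induction ws arbitrary: S)
  case Nil
  then show ?case by (auto simp: conv_prod_def split: if_splits)
next
  case (Cons w ws)
  then have "subset_conv (singleton_fun n w) (conv_prod n ws) S \<noteq> 0" by (simp add: conv_prod_def)
  then obtain A where A: "A \<subseteq> S" "singleton_fun n w A \<noteq> 0" "conv_prod n ws (S - A) \<noteq> 0"
    unfolding subset_conv_def by (metis (no_types, lifting) PowD mult_eq_0_iff sum.neutral)
  have "\<exists>j<n. A = {j}"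
  proof (rule ccontr)
    assume "\<not> (\<exists>j<n. A = {j})"
    then have "singleton_fun n w A = 0"
      unfolding singleton_fun_def by (intro sum.neutral) auto
    with A(2) show False ..
  qed
  then obtain j where j: "j < n" "A = {j}" by blast
  have "S - A \<subseteq> {..<n}" "card (S - A) = length ws" using Cons.IH[OF A(3)] by auto
  moreover have "finite S" using calculation(1) j finite_subset
    by (metis finite.emptyI finite_Diff2 finite_insert finite_lessThan)
  ultimately show ?case using A(1) j card_Suc_Diff1[of S j] by auto
qed

text \<open>This handles the empty power of \<open>\<omega>\<close> in the Hodge--Riemann condition
  at \<open>r = 0\<close>.\<close>

lemma wedge_diag_form_one: "wedge (diag_form f) form_one = diag_form f"
proof -
  have one: "form_one = diag_form (\<lambda>S. of_bool (S = {}))"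
    by (auto simp: form_one_def diag_form_def fun_eq_iff numeral_2_eq_2)
  have "subset_conv f (\<lambda>S. of_bool (S = {})) S = f S" if "finite S" for S
  proof -
    have "subset_conv f (\<lambda>S. of_bool (S = {})) S = (\<Sum>A\<in>{S}. f A * of_bool (S - A = {}))"
      using that unfolding subset_conv_def by (intro sum.mono_neutral_right) auto
    then show ?thesis by simp
  qed
  then show ?thesis unfolding one wedge_diag_form by (auto simp: diag_form_def fun_eq_iff)
qed

subsection \<open>Counting pairs by type\<close>

definition class_count :: "nat set \<Rightarrow> nat \<Rightarrow> real" where
  "class_count U r = real (card {i \<in> U. cls i = r})"

lemma cls_less: "cls i < 4"
proof -
  have "i mod 3 < 4" by (rule less_trans[of _ 3]) simp_all
  then show ?thesis by (simp add: cls_def)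
qed

lemma sum_cls:
  fixes f :: "nat \<Rightarrow> real"
  assumes "finite U"
  shows "(\<Sum>i\<in>U. f (cls i)) = (\<Sum>r<4. class_count U r * f r)"
proof -
  have "(\<Sum>i\<in>U. f (cls i)) = (\<Sum>r<4. \<Sum>i\<in>{i \<in> U. cls i = r}. f (cls i))"
    using assms cls_less by (intro sum.group[symmetric]) auto
  then show ?thesis by (simp add: class_count_def)
qed

lemma class_count_remove:
  assumes "finite U" "i \<in> U"
  shows "class_count (U - {i}) r = class_count U r - of_bool (cls i = r)"
proof (cases "cls i = r")
  case True
  have "{j \<in> U - {i}. cls j = r} = {j \<in> U. cls j = r} - {i}" by auto
  moreover have "card {j \<in> U. cls j = r} = Suc (card ({j \<in> U. cls j = r} - {i}))"
    using True assms by (intro card_Suc_Diff1[symmetric]) auto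
  ultimately show ?thesis using True by (simp only: class_count_def) simp
next
  case False
  then have "{j \<in> U - {i}. cls j = r} = {j \<in> U. cls j = r}" by auto
  then show ?thesis using False by (simp add: class_count_def)
qed

lemma class_count_remove_pair:
  assumes "finite U" "i \<in> U" "j \<in> U" "i \<noteq> j"
  shows "class_count (U - {i} - {j}) = remove_pair (class_count U) (cls i) (cls j)"
  using assms by (simp add: class_count_remove remove_pair_def fun_eq_iff)

text \<open>Once \<open>i\<close> is chosen, its own class has one member fewer; this is the
  \<open>of_bool\<close> correction in \<open>pair_sum\<close>.\<close>

lemma sum_pairs_cls:
  assumes "finite U"
  shows "(\<Sum>i\<in>U. \<Sum>j\<in>U - {i}. h (cls i) (cls j)) = pair_sum h (class_count U)"
proof -
  have "(\<Sum>i\<in>U. \<Sum>j\<in>U - {i}. h (cls i) (cls j))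
      = (\<Sum>i\<in>U. \<Sum>q<4. (class_count U q - of_bool (cls i = q)) * h (cls i) q)"
    using assms by (intro sum.cong[OF refl], subst sum_cls) (simp_all add: class_count_remove)
  also have "\<dots> = (\<Sum>p<4. class_count U p * (\<Sum>q<4. (class_count U q - of_bool (p = q)) * h p q))"
    using assms by (rule sum_cls)
  finally show ?thesis
    unfolding pair_sum_def by (simp add: sum_distrib_left mult_ac)
qed

lemma class_count_lessThan: "class_count {..<m + 6} = class_sizes m"
proof
  fix r
  have "{i \<in> {..<m + 6}. cls i = r} = 
    (if r = 3 then {6..<m + 6} else if r < 3 then {r, r + 3} else {})"
  proof -
    have "cls i = (if i = 0 \<or> i = 3 then 0 else if i = 1 \<or> i = 4 then 1 else if i = 2 \<or> i = 5 then 2 else 3)" for i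
    proof (cases "i < 6")
      case True
      then have "i = 0 \<or> i = 1 \<or> i = 2 \<or> i = 3 \<or> i = 4 \<or> i = 5" by linarith
      then show ?thesis by (auto simp: cls_def)
    qed (auto simp: cls_def)
    then show ?thesis by (auto split: if_splits)
  qed
  then show "class_count {..<m + 6} r = class_sizes m r"
    by (simp add: class_count_def class_sizes_def)
qed

text \<open>Class 3 has only \<open>m\<close> members here, while types 2 and 3 require one and two
  of them.\<close>

lemma pair_type_cls_le:
  assumes "i < m + 6" "j < m + 6" "i \<noteq> j"
  shows "pair_type (cls i) (cls j) \<le> m + 1"
proof -
  have "i mod 3 \<noteq> 3" for i :: nat by (metis mod_less_divisor less_irrefl zero_less_numeral)
  then have "cls i = 3 \<longleftrightarrow> \<not> i < 6" for i by (simp add: cls_def)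
  then show ?thesis using assms by (auto simp: pair_type_def)
qed

text \<open>Summing over both orderings yields a function of sets without choosing an order: a pair
  receives twice its weight, any other set receives 0.\<close>

definition pair_weight :: "(nat \<Rightarrow> real) \<Rightarrow> nat set \<Rightarrow> real" where
  "pair_weight v A = (\<Sum>(i, j)\<in>{(i, j). i \<noteq> j \<and> {i, j} = A}. v (pair_type (cls i) (cls j)))"

lemma pair_type_commute: "pair_type p q = pair_type q p"
  by (simp add: pair_type_def)

lemma pair_weight_insert:
  assumes "i \<noteq> j"
  shows "pair_weight v {i, j} = 2 * v (pair_type (cls i) (cls j))"
proof -
  have "{(x, y). x \<noteq> y \<and> {x, y} = {i, j}} = {(i, j), (j, i)}"
    using assms by (auto simp: doubleton_eq_iff)
  then show ?thesis using assms by (simp add: pair_weight_def pair_type_commute)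
qed

lemma sum_pair_weight:
  assumes "finite U"
  shows "(\<Sum>A | A \<subseteq> U \<and> card A = 2. pair_weight v A * F (U - A))
    = (\<Sum>i\<in>U. \<Sum>j\<in>U - {i}. v (pair_type (cls i) (cls j)) * F (U - {i} - {j}))"
proof -
  let ?P = "SIGMA i:U. U - {i}" and ?g = "\<lambda>(i, j). {i, j}"
  let ?h = "\<lambda>(i, j). v (pair_type (cls i) (cls j)) * F (U - {i} - {j})"
  have "(\<Sum>i\<in>U. \<Sum>j\<in>U - {i}. v (pair_type (cls i) (cls j)) * F (U - {i} - {j})) = sum ?h ?P"
    using assms by (subst sum.Sigma) auto
  also have "\<dots> = (\<Sum>A | A \<subseteq> U \<and> card A = 2. sum ?h {x \<in> ?P. ?g x = A})"
    using assms by (intro sum.group[symmetric]) (auto simp: card_insert_if)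
  also have "\<dots> = (\<Sum>A | A \<subseteq> U \<and> card A = 2. pair_weight v A * F (U - A))"
  proof (rule sum.cong[OF refl])
    fix A assume A: "A \<in> {A. A \<subseteq> U \<and> card A = 2}"
    have eq: "{x \<in> ?P. ?g x = A} = {(i, j). i \<noteq> j \<and> {i, j} = A}"
      using A by auto
    have "U - {i} - {j} = U - A" if "{i, j} = A" for i j using that by auto
    then have "sum ?h {x \<in> ?P. ?g x = A}
        = (\<Sum>(i, j)\<in>{(i, j). i \<noteq> j \<and> {i, j} = A}. v (pair_type (cls i) (cls j)) * F (U - A))"
      unfolding eq by (intro sum.cong) auto
    then show "sum ?h {x \<in> ?P. ?g x = A} = pair_weight v A * F (U - A)"
      by (simp add: pair_weight_def sum_distrib_right case_prod_unfold)
  qed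
  finally show ?thesis by simp
qed

text \<open>The set \<open>U\<close> is the complement of a pair in the first \<open>m + 6\<close>
  indices, so the sum is the kernel equation for the type of that pair.\<close>

lemma sum_pair_weight_gram:
  assumes U: "U \<subseteq> {..<m + 6}" "card U = m + 4"
    and ker: "\<And>p q. p < 4 \<Longrightarrow> q < 4 \<Longrightarrow> pair_type p q \<le> m + 1 \<Longrightarrow>
       mult_sum s t v (remove_pair (class_sizes m) p q) = 0"
  shows "(\<Sum>A | A \<subseteq> U \<and> card A = 2. pair_weight v A * pair_sum (gram s t) (class_count (U - A))) = 0"
proof -
  have fin: "finite U" using U(1) finite_subset by blast
  have "card ({..<m + 6} - U) = 2" using U by (simp add: card_Diff_subset fin)
  then obtain x y where xy: "{..<m + 6} - U = {x, y}" "x \<noteq> y" by (auto simp: card_2_iff)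
  then have "U = {..<m + 6} - {x} - {y}" using U(1) by auto
  then have U_count: "class_count U = remove_pair (class_sizes m) (cls x) (cls y)"
    using xy by (metis class_count_remove_pair class_count_lessThan Diff_iff finite_lessThan insertCI)
  have "x < m + 6" "y < m + 6" using xy by auto
  have "(\<Sum>A | A \<subseteq> U \<and> card A = 2. pair_weight v A * pair_sum (gram s t) (class_count (U - A)))
    = (\<Sum>i\<in>U. \<Sum>j\<in>U - {i}. v (pair_type (cls i) (cls j)) * pair_sum (gram s t) (class_count (U - {i} - {j})))"
    using fin by (rule sum_pair_weight)
  also have "\<dots> = (\<Sum>i\<in>U. \<Sum>j\<in>U - {i}. v (pair_type (cls i) (cls j))
      * pair_sum (gram s t) (remove_pair (class_count U) (cls i) (cls j)))"
    using fin by (intro sum.cong refl) (auto simp: class_count_remove_pair)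
  also have "\<dots> = mult_sum s t v (class_count U)"
    unfolding mult_sum_def by (rule sum_pairs_cls[OF fin])
  also have "\<dots> = 0"
    unfolding U_count using \<open>x < m + 6\<close> \<open>y < m + 6\<close> xy(2) by (intro ker cls_less pair_type_cls_le)
  finally show ?thesis .
qed

subsection \<open>The matrix of forms\<close>

text \<open>The value 0 at class 3 makes the blocks of that class scalar.\<close>

definition cube_root :: "nat \<Rightarrow> complex" where
  "cube_root r = (if r = 0 then 1 else if r = 1 then Complex (- 1 / 2) (sqrt 3 / 2)
     else if r = 2 then Complex (- 1 / 2) (- sqrt 3 / 2) else 0)"

definition diag_entry :: "real \<Rightarrow> nat \<Rightarrow> real" where
  "diag_entry s j = (if j < 6 then 1 else s)"

definition off_diag_entry :: "real \<Rightarrow> nat \<Rightarrow> complex" where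
  "off_diag_entry t j = of_real (sqrt t) * cube_root (cls j)"

definition entry :: "real \<Rightarrow> real \<Rightarrow> nat \<Rightarrow> nat \<Rightarrow> nat \<Rightarrow> complex" where
  "entry s t a b j = (if a = b then if a < 2 then of_real (diag_entry s j) else 1
     else if a = 0 \<and> b = 1 then off_diag_entry t j
     else if a = 1 \<and> b = 0 then cnj (off_diag_entry t j) else 0)"

definition witness :: "nat \<Rightarrow> nat \<Rightarrow> real \<Rightarrow> real \<Rightarrow> form mat" where
  "witness n k s t = mat k k (\<lambda>(a, b). diag_form (singleton_fun n (entry s t a b)))"

lemma cls_cases:
  obtains "cls j = 0" "j < 6" | "cls j = 1" "j < 6" | "cls j = 2" "j < 6" | "cls j = 3" "\<not> j < 6"
proof -
  have "j mod 3 < 3" by simp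
  then have "j mod 3 = 0 \<or> j mod 3 = 1 \<or> j mod 3 = 2" by linarith
  then show ?thesis using that by (cases "j < 6") (auto simp: cls_def)
qed

text \<open>Distinct cube roots of unity have real inner product \<open>- 1 / 2\<close>, which
  produces the value \<open>1 + t / 2\<close> across pairs.\<close>

lemma gram_entry:
  assumes "t \<ge> 0"
  shows "diag_entry s i * diag_entry s j - Re (off_diag_entry t i * cnj (off_diag_entry t j)) = gram s t (cls i) (cls j)"
proof -
  have t: "sqrt t * sqrt t = t" "sqrt t * (sqrt t * x) = t * x" for x
    using assms by (simp_all flip: mult.assoc)
  have 3: "sqrt 3 * sqrt 3 = (3::real)" by simp
  show ?thesis
    by (cases i rule: cls_cases; cases j rule: cls_cases)
      (simp_all add: diag_entry_def off_diag_entry_def cube_root_def gram_def t 3 assms power2_eq_square field_simps)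
qed

text \<open>A permutation moving an index outside \<open>{0, 1}\<close> meets a zero entry. The
  identity and one transposition remain, and their difference is the sum of polarised determinants
  over ordered pairs in \<open>S\<close>.\<close>

lemma form_det_witness:
  assumes "t \<ge> 0"
  shows "\<exists>f. form_det (witness n (m + 2) s t) = diag_form f \<and>
    (\<forall>S. f S \<noteq> 0 \<longrightarrow> S \<subseteq> {..<n} \<and> card S = m + 2) \<and>
    (\<forall>S. S \<subseteq> {..<n} \<longrightarrow> card S = m + 2 \<longrightarrow>
       f S = of_real (fact m * pair_sum (gram s t) (class_count S)))"
proof -
  let ?k = "m + 2"
  let ?e = "entry s t"
  let ?ws = "\<lambda>\<pi>. map (\<lambda>a. ?e a (\<pi> a)) [0..<?k]"
  define f where "f = (\<lambda>S. \<Sum>\<pi> | \<pi> permutes {..<?k}. of_int (sign \<pi>) * conv_prod n (?ws \<pi>) S)"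
  have ws: "?ws \<pi> = ?e 0 (\<pi> 0) # ?e 1 (\<pi> 1) # replicate m (\<lambda>_. 1)" if "\<And>a. a \<ge> 2 \<Longrightarrow> \<pi> a = a" for \<pi>
  proof -
    have "[0..<?k] = 0 # 1 # [2..<?k]" by (simp add: upt_conv_Cons numeral_2_eq_2)
    moreover have "map (\<lambda>a. ?e a (\<pi> a)) [2..<?k] = map (\<lambda>_ _. 1) [2..<?k]"
      using that by (intro map_cong ext refl) (auto simp: entry_def)
    then have "map (\<lambda>a. ?e a (\<pi> a)) [2..<?k] = replicate m (\<lambda>_. 1)"
      by (simp only: map_replicate_const length_upt diff_add_inverse2)
    ultimately show ?thesis by simp
  qed
  have det: "form_det (witness n ?k s t) = diag_form f"
  proof (intro ext)
    fix I J :: "nat set"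
    have "form_det (witness n ?k s t) I J
        = (\<Sum>\<pi> | \<pi> permutes {..<?k}. of_int (sign \<pi>) * diag_form (conv_prod n (?ws \<pi>)) I J)"
    proof -
      have "wedge_list (map (\<lambda>a. witness n ?k s t $$ (a, \<pi> a)) [0..<?k]) = diag_form (conv_prod n (?ws \<pi>))"
        if "\<pi> permutes {..<?k}" for \<pi>
      proof -
        have "map (\<lambda>a. witness n ?k s t $$ (a, \<pi> a)) [0..<?k]
            = map (\<lambda>w. diag_form (singleton_fun n w)) (?ws \<pi>)"
          using permutes_in_image[OF that] by (auto simp: witness_def)
        then show ?thesis by (simp only: wedge_list_diag_form)
      qed
      then show ?thesis
        unfolding form_det_def by (intro sum.cong) (simp_all add: witness_def)
    qed
    also have "\<dots> = diag_form f I J"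
    proof (cases "I = J \<and> finite I")
      case True
      then have "J = I" "finite I" by auto
      then show ?thesis by (simp add: diag_form_def f_def sum_distrib_left mult_ac)
    next
      case False
      then have "diag_form g I J = 0" for g by (simp only: diag_form_def if_False)
      then show ?thesis by simp
    qed
    finally show "form_det (witness n ?k s t) I J = diag_form f I J" .
  qed
  have f: "f S = conv_prod n (?e 0 0 # ?e 1 1 # replicate m (\<lambda>_. 1)) S
      - conv_prod n (?e 0 1 # ?e 1 0 # replicate m (\<lambda>_. 1)) S" for S
  proof -
    have "f S = (\<Sum>\<pi> | \<pi> permutes {0, 1::nat}. of_int (sign \<pi>) * conv_prod n (?ws \<pi>) S)"
      unfolding f_def
    proof (rule sum.mono_neutral_right)
      show "{\<pi>. \<pi> permutes {0, 1::nat}} \<subseteq> {\<pi>. \<pi> permutes {..<?k}}"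
        by (auto elim: permutes_subset)
      show "\<forall>\<pi>\<in>{\<pi>. \<pi> permutes {..<?k}} - {\<pi>. \<pi> permutes {0, 1::nat}}. of_int (sign \<pi>) * conv_prod n (?ws \<pi>) S = 0"
      proof
        fix \<pi> assume \<pi>: "\<pi> \<in> {\<pi>. \<pi> permutes {..<?k}} - {\<pi>. \<pi> permutes {0, 1::nat}}"
        then have "\<exists>a. a \<notin> {0, 1} \<and> \<pi> a \<noteq> a"
          using permutes_superset[of \<pi> "{..<?k}" "{0, 1}"] by auto
        then obtain a where a: "a \<noteq> 0" "a \<noteq> 1" "\<pi> a \<noteq> a" by auto
        then have "a < ?k" using \<pi> permutes_not_in[of \<pi> "{..<?k}" a] by auto
        then have "?e a (\<pi> a) \<in> set (?ws \<pi>)" by (simp add: image_iff del: upt_Suc) force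
        moreover have "?e a (\<pi> a) j = 0" for j using a by (simp add: entry_def)
        ultimately show "of_int (sign \<pi>) * conv_prod n (?ws \<pi>) S = 0"
          by (simp only: conv_prod_zero mult_zero_right)
      qed
    qed (simp add: finite_permutations)
    also have "{\<pi>. \<pi> permutes {0, 1::nat}} = {id, transpose 0 1}"
      by (auto simp: permutes_doubleton_iff)
    also have "(\<Sum>\<pi>\<in>{id, transpose 0 1}. of_int (sign \<pi>) * conv_prod n (?ws \<pi>) S)
        = conv_prod n (?ws id) S - conv_prod n (?ws (transpose 0 1)) S"
    proof -
      have "id \<noteq> transpose 0 (1::nat)" by (metis id_apply transpose_apply_first zero_neq_one)
      then show ?thesis by (simp add: sign_swap_id del: upt_Suc map_eq_conv)
    qed
    also have "?ws id = ?e 0 0 # ?e 1 1 # replicate m (\<lambda>_. 1)" by (subst ws) auto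
    also have "?ws (transpose 0 1) = ?e 0 1 # ?e 1 0 # replicate m (\<lambda>_. 1)"
      by (subst ws) (auto simp: transpose_def)
    finally show ?thesis .
  qed
  have "f S = of_real (fact m * pair_sum (gram s t) (class_count S))"
    if S: "S \<subseteq> {..<n}" "card S = ?k" for S
  proof -
    have fin: "finite S" using S(1) finite_subset by blast
    let ?z = "off_diag_entry t"
    \<comment> \<open>Exchanging \<open>i\<close> and \<open>j\<close> conjugates the terms, so the
      double sum is real.\<close>
    have offdiag: "(\<Sum>i\<in>S. \<Sum>j\<in>S - {i}. ?z i * cnj (?z j)) = of_real (\<Sum>i\<in>S. \<Sum>j\<in>S - {i}. Re (?z i * cnj (?z j)))"
      (is "?X = _")
    proof -
      have "cnj ?X = (\<Sum>i\<in>S. \<Sum>j\<in>{j\<in>S. i \<noteq> j}. ?z j * cnj (?z i))"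
        by (simp add: mult.commute) (intro sum.cong refl; auto)
      also have "\<dots> = (\<Sum>j\<in>S. \<Sum>i\<in>{i\<in>S. i \<noteq> j}. ?z j * cnj (?z i))"
        using fin by (rule sum.swap_restrict) (rule fin)
      also have "\<dots> = ?X"
        by (intro sum.cong refl) auto
      finally have "?X \<in> \<real>"
        by (simp only: Reals_cnj_iff)
      then have "?X = of_real (Re ?X)"
        by (simp only: of_real_Re)
      then show ?thesis by simp
    qed
    have "f S = fact m * ((\<Sum>i\<in>S. \<Sum>j\<in>S - {i}. of_real (diag_entry s i * diag_entry s j))
        - (\<Sum>i\<in>S. \<Sum>j\<in>S - {i}. ?z i * cnj (?z j)))"
      unfolding f conv_prod_Cons2_replicate_1[OF S] by (simp add: entry_def right_diff_distrib)
    also have "\<dots> = of_real (fact m * (\<Sum>i\<in>S. \<Sum>j\<in>S - {i}. gram s t (cls i) (cls j)))"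
      unfolding offdiag gram_entry[OF assms, symmetric] by (simp add: sum_subtractf)
    finally show ?thesis using fin by (simp only: sum_pairs_cls)
  qed
  moreover have "S \<subseteq> {..<n} \<and> card S = ?k" if "f S \<noteq> 0" for S
  proof -
    have "conv_prod n (?e 0 0 # ?e 1 1 # replicate m (\<lambda>_. 1)) S \<noteq> 0
        \<or> conv_prod n (?e 0 1 # ?e 1 0 # replicate m (\<lambda>_. 1)) S \<noteq> 0"
      using that unfolding f by auto
    then show ?thesis by (elim disjE) (drule conv_prod_support, simp)+
  qed
  ultimately show ?thesis using det by blast
qed

lemma singleton_fun_form_eq:
  "diag_form (singleton_fun n w) I J = (\<Sum>j<n. if I = {j} \<and> J = {j} then \<i> / 2 * w j else 0)"
proof (cases "\<exists>j<n. I = {j} \<and> J = {j}")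
  case True
  then show ?thesis by (auto simp: diag_form_def singleton_fun_def numeral_2_eq_2)
next
  case False
  then have "(\<Sum>j<n. if I = {j} \<and> J = {j} then \<i> / 2 * w j else 0) = 0"
    by (intro sum.neutral) auto
  moreover have "diag_form (singleton_fun n w) I J = 0"
    using False unfolding diag_form_def singleton_fun_def by (auto intro!: sum.neutral)
  ultimately show ?thesis by simp
qed

lemma diag_form_singleton_fun_in_forms: "diag_form (singleton_fun n w) \<in> forms n 1 1"
proof -
  have "\<exists>j<n. I = {j} \<and> J = {j}" if "diag_form (singleton_fun n w) I J \<noteq> 0" for I J
  proof (rule ccontr)
    assume "\<not> (\<exists>j<n. I = {j} \<and> J = {j})"
    then have "diag_form (singleton_fun n w) I J = 0"
      unfolding singleton_fun_form_eq by (intro sum.neutral) auto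
    with that show False ..
  qed
  then show ?thesis unfolding forms_def by fastforce
qed

lemma form_cnj_diag_form_singleton_fun:
  "form_cnj (diag_form (singleton_fun n w)) = diag_form (singleton_fun n (\<lambda>j. cnj (w j)))"
proof (intro ext)
  fix I J
  have "form_cnj (diag_form (singleton_fun n w)) I J
      = (\<Sum>j<n. (-1) ^ (card I * card J) * cnj (if J = {j} \<and> I = {j} then \<i> / 2 * w j else 0))"
    by (simp only: form_cnj_def singleton_fun_form_eq cnj_sum sum_distrib_left)
  \<comment> \<open>On singletons the sign is \<open>-1\<close> and cancels against the conjugation
    of \<open>\<i>\<close>.\<close>
  also have "\<dots> = (\<Sum>j<n. if I = {j} \<and> J = {j} then \<i> / 2 * cnj (w j) else 0)"
    by (intro sum.cong) auto
  finally show "form_cnj (diag_form (singleton_fun n w)) I J = diag_form (singleton_fun n (\<lambda>j. cnj (w j))) I J"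
    by (simp only: singleton_fun_form_eq)
qed

lemma coord_volume_one:
  assumes "j < n"
  shows "coord_volume n (1\<^sub>m n) j I J = (if I = {j} \<and> J = {j} then \<i> / 2 else 0)"
proof -
  have coord: "coord_form n (1\<^sub>m n) j = (\<lambda>I J. if I = {j} \<and> J = {} then 1 else 0)"
  proof (intro ext)
    fix I J
    have "coord_form n (1\<^sub>m n) j I J = (\<Sum>i<n. if i = j then if I = {j} \<and> J = {} then 1 else 0 else 0)"
      unfolding coord_form_def using assms by (intro sum.cong) auto
    then show "coord_form n (1\<^sub>m n) j I J = (if I = {j} \<and> J = {} then 1 else 0)"
      using assms by simp
  qed
  have conj: "form_cnj (coord_form n (1\<^sub>m n) j) = (\<lambda>I J. if I = {} \<and> J = {j} then 1 else 0)"
    unfolding coord form_cnj_def by (auto simp: fun_eq_iff)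
  let ?t = "\<lambda>A B. (-1) ^ (card B * card (I - A)) * shuffle_sign A (I - A) * shuffle_sign B (J - B)
       * (if A = {j} \<and> B = {} then 1 else 0) * (if I - A = {} \<and> J - B = {j} then 1 else (0::complex))"
  have eq: "wedge (coord_form n (1\<^sub>m n) j) (form_cnj (coord_form n (1\<^sub>m n) j)) I J = (\<Sum>A\<in>Pow I. \<Sum>B\<in>Pow J. ?t A B)"
    unfolding conj unfolding coord by (simp add: wedge_def)
  have "(\<Sum>A\<in>Pow I. \<Sum>B\<in>Pow J. ?t A B) = (if I = {j} \<and> J = {j} then 1 else 0)"
  proof (cases "I = {j} \<and> J = {j}")
    case True
    moreover have "shuffle_sign {} {j} = 1" "shuffle_sign {j} {} = 1" by (simp_all add: shuffle_sign_def)
    ultimately show ?thesis by (simp add: Pow_insert)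
  next
    case False
    have "?t A B = 0" if "A \<in> Pow I" "B \<in> Pow J" for A B
      using that False by (auto simp: subset_antisym)
    then show ?thesis using False by (simp add: sum.neutral)
  qed
  then show ?thesis unfolding coord_volume_def eq by simp
qed

lemma witness_carrier: "witness n k s t \<in> carrier_mat k k"
  by (simp add: witness_def)

lemma cnj_entry: "cnj (entry s t a b j) = entry s t b a j"
  by (simp add: entry_def)

lemma hermitian_form_mat_witness: "hermitian_form_mat n k (witness n k s t)"
  unfolding hermitian_form_mat_def
  by (simp add: witness_carrier witness_def diag_form_singleton_fun_in_forms[unfolded One_nat_def]
      form_cnj_diag_form_singleton_fun cnj_entry)

text \<open>The construction lives in the standard coordinates, so the identity matrix serves as
  \<open>A\<close>.\<close>

lemma SD_witness: "SD n k (witness n k s t)"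
  unfolding SD_def
proof (intro exI conjI allI impI)
  let ?B = "\<lambda>j. mat k k (\<lambda>(a, b). entry s t a b j)"
  show "1\<^sub>m n \<in> carrier_mat n n" by simp
  show "invertible_mat (1\<^sub>m n :: complex mat)"
    unfolding invertible_mat_def inverts_mat_def by (auto intro!: exI[of _ "1\<^sub>m n"])
  fix j assume "j < n"
  show "?B j \<in> carrier_mat k k" by simp
  show "mat_adjoint (?B j) = ?B j"
    by (intro eq_matI) (simp_all add: mat_adjoint_def mat_of_rows_def conjugate_complex_def cnj_entry)
next
  fix a b assume "a < k" "b < k"
  then show "witness n k s t $$ (a, b)
      = (\<lambda>I J. \<Sum>j<n. mat k k (\<lambda>(a, b). entry s t a b j) $$ (a, b) * coord_volume n (1\<^sub>m n) j I J)"
    by (auto simp: witness_def singleton_fun_form_eq coord_volume_one fun_eq_iff intro!: sum.cong)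
qed

section \<open>Griffiths positivity\<close>

lemma kaehler_diag_form_singleton_fun:
  assumes "\<And>j. j < n \<Longrightarrow> 0 < c j"
  shows "kaehler n (diag_form (singleton_fun n (\<lambda>j. of_real (c j))))"
  unfolding kaehler_def
proof (intro conjI ballI impI)
  let ?\<alpha> = "diag_form (singleton_fun n (\<lambda>j. of_real (c j)))"
  show "?\<alpha> \<in> real_forms n 1"
    by (simp add: real_forms_def diag_form_singleton_fun_in_forms[unfolded One_nat_def] form_cnj_diag_form_singleton_fun)
  fix u :: "complex vec" assume u: "u \<in> carrier_vec n" "u \<noteq> 0\<^sub>v n"
  have "assoc_hermitian n ?\<alpha> u u = (\<Sum>i<n. \<Sum>j<n. if i = j then of_real (c i) * (u $ i * cnj (u $ i)) else 0)"
    unfolding assoc_hermitian_def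
  proof (intro sum.cong refl)
    fix i j assume ij: "i \<in> {..<n}" "j \<in> {..<n}"
    have "?\<alpha> {i} {j} = (\<Sum>l<n. if l = i then if i = j then \<i> / 2 * of_real (c i) else 0 else 0)"
      unfolding singleton_fun_form_eq by (intro sum.cong) auto
    then show "2 / \<i> * ?\<alpha> {i} {j} * u $ i * cnj (u $ j)
        = (if i = j then of_real (c i) * (u $ i * cnj (u $ i)) else 0)"
      using ij by simp
  qed
  also have "\<dots> = of_real (\<Sum>i<n. c i * (cmod (u $ i))\<^sup>2)"
    by (simp flip: complex_norm_square)
  finally have "Re (assoc_hermitian n ?\<alpha> u u) = (\<Sum>i<n. c i * (cmod (u $ i))\<^sup>2)" by simp
  moreover obtain i where "i < n" "u $ i \<noteq> 0"
    using u by (metis carrier_vecD eq_vecI index_zero_vec(1) index_zero_vec(2))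
  then have "(\<Sum>i<n. c i * (cmod (u $ i))\<^sup>2) > 0"
    using assms by (intro sum_pos2[of _ i]) (auto intro!: mult_nonneg_nonneg less_imp_le[OF assms])
  ultimately show "0 < Re (assoc_hermitian n ?\<alpha> u u)" by simp
qed

text \<open>This is positive definiteness of the block \<open>C_j\<close>: the modulus is
  \<open>sqrt t\<close> against the diagonal entry 1 for the first six indices, and 0 against
  \<open>s\<close> for the others.\<close>

lemma cmod_off_diag_entry_less:
  assumes "0 < s" "0 \<le> t" "t < 1"
  shows "cmod (off_diag_entry t j) < diag_entry s j"
proof -
  have "cmod (cube_root r) \<le> 1" for r
    by (simp add: cube_root_def cmod_def power2_eq_square)
  then have "cmod (off_diag_entry t j) \<le> sqrt t * 1"
    using assms(2) unfolding off_diag_entry_def norm_mult by (intro mult_mono) auto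
  also have "\<dots> < 1" using assms by simp
  finally have "cmod (off_diag_entry t j) < 1" .
  then show ?thesis
    using assms(1) by (auto simp: diag_entry_def off_diag_entry_def cube_root_def cls_def)
qed

lemma griffiths_positive_witness:
  assumes st: "0 < s" "0 \<le> t" "t < 1"
  shows "griffiths_positive n (m + 2) (witness n (m + 2) s t)"
  unfolding griffiths_positive_def
proof (intro ballI impI)
  let ?k = "m + 2"
  fix \<theta> :: "complex vec" assume \<theta>: "\<theta> \<in> carrier_vec ?k" "\<theta> \<noteq> 0\<^sub>v ?k"
  \<comment> \<open>The value at \<open>\<theta>\<close> of the Hermitian form of
    \<open>B_j\<close>, split into the block \<open>C_j\<close> and the identity block.\<close>
  define c where "c = (\<lambda>j. diag_entry s j * ((cmod (\<theta> $ 0))\<^sup>2 + (cmod (\<theta> $ 1))\<^sup>2)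
    + 2 * Re (\<theta> $ 0 * cnj (\<theta> $ 1) * off_diag_entry t j) + (\<Sum>a<m. (cmod (\<theta> $ (a + 2)))\<^sup>2))"
  have c: "(\<Sum>a<?k. \<Sum>b<?k. \<theta> $ a * cnj (\<theta> $ b) * entry s t a b j) = of_real (c j)" for j
  proof -
    have split: "sum g {..<?k} = g 0 + g 1 + (\<Sum>a<m. g (a + 2))" for g :: "nat \<Rightarrow> complex"
      by (simp add: sum.lessThan_Suc_shift add.assoc del: sum.lessThan_Suc)
    have sq: "x * cnj x = of_real ((cmod x)\<^sup>2)" for x by (simp only: complex_norm_square)
    have re: "\<theta> $ 0 * cnj (\<theta> $ 1) * off_diag_entry t j + \<theta> $ 1 * cnj (\<theta> $ 0) * cnj (off_diag_entry t j)
        = of_real (2 * Re (\<theta> $ 0 * cnj (\<theta> $ 1) * off_diag_entry t j))"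
      by (simp add: complex_eq_iff algebra_simps)
    have row: "(\<Sum>b<?k. \<theta> $ (a + 2) * cnj (\<theta> $ b) * entry s t (a + 2) b j) = of_real ((cmod (\<theta> $ (a + 2)))\<^sup>2)"
      if "a < m" for a
    proof -
      have "(\<Sum>b<?k. \<theta> $ (a + 2) * cnj (\<theta> $ b) * entry s t (a + 2) b j)
          = (\<Sum>b<?k. if b = a + 2 then \<theta> $ (a + 2) * cnj (\<theta> $ (a + 2)) else 0)"
        by (intro sum.cong) (auto simp: entry_def)
      then show ?thesis using that by (simp add: sq)
    qed
    have row01: "(\<Sum>b<?k. \<theta> $ a * cnj (\<theta> $ b) * entry s t a b j)
        = \<theta> $ a * cnj (\<theta> $ 0) * entry s t a 0 j + \<theta> $ a * cnj (\<theta> $ 1) * entry s t a 1 j" if "a < 2" for a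
      unfolding split using that by (simp add: entry_def)
    have "(\<Sum>a<?k. \<Sum>b<?k. \<theta> $ a * cnj (\<theta> $ b) * entry s t a b j)
       = of_real (diag_entry s j) * (\<theta> $ 0 * cnj (\<theta> $ 0) + \<theta> $ 1 * cnj (\<theta> $ 1))
       + (\<theta> $ 0 * cnj (\<theta> $ 1) * off_diag_entry t j + \<theta> $ 1 * cnj (\<theta> $ 0) * cnj (off_diag_entry t j))
       + of_real (\<Sum>a<m. (cmod (\<theta> $ (a + 2)))\<^sup>2)"
      unfolding split[of "\<lambda>a. \<Sum>b<?k. _ a b"]
      using row row01[of 0] row01[of 1] by (simp add: entry_def algebra_simps)
    then show ?thesis unfolding re sq by (simp add: c_def)
  qed
  have "c j > 0" for j
  proof -
    let ?x = "cmod (\<theta> $ 0)" and ?y = "cmod (\<theta> $ 1)" and ?z = "cmod (off_diag_entry t j)" and ?u = "diag_entry s j"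
    let ?R = "\<Sum>a<m. (cmod (\<theta> $ (a + 2)))\<^sup>2"
    have "\<bar>Re (\<theta> $ 0 * cnj (\<theta> $ 1) * off_diag_entry t j)\<bar> \<le> ?x * ?y * ?z"
      using abs_Re_le_cmod[of "\<theta> $ 0 * cnj (\<theta> $ 1) * off_diag_entry t j"] by (simp add: norm_mult)
    moreover have "2 * (?x * ?y * ?z) \<le> (?x\<^sup>2 + ?y\<^sup>2) * ?z"
    proof -
      have "2 * (?x * ?y) \<le> ?x\<^sup>2 + ?y\<^sup>2" using sum_squares_bound[of ?x ?y] by (simp add: mult.assoc)
      then have "2 * (?x * ?y) * ?z \<le> (?x\<^sup>2 + ?y\<^sup>2) * ?z" by (rule mult_right_mono) simp
      then show ?thesis by (simp add: mult.assoc)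
    qed
    \<comment> \<open>Both summands of the lower bound are nonnegative, and a nonzero coordinate of
      \<open>\<theta>\<close> makes one of them positive.\<close>
    ultimately have ge: "c j \<ge> (?u - ?z) * (?x\<^sup>2 + ?y\<^sup>2) + ?R"
      unfolding c_def by (simp add: algebra_simps)
    have uz: "?u - ?z > 0" using cmod_off_diag_entry_less[OF st] by simp
    have R: "?R \<ge> 0" by (intro sum_nonneg) simp
    obtain i where i: "i < ?k" "\<theta> $ i \<noteq> 0"
      using \<theta> by (metis carrier_vecD eq_vecI index_zero_vec(1) index_zero_vec(2))
    have "(?u - ?z) * (?x\<^sup>2 + ?y\<^sup>2) + ?R > 0"
    proof (cases "i < 2")
      case True
      then have "i = 0 \<or> i = 1" by linarith
      then have "?x\<^sup>2 + ?y\<^sup>2 > 0" using i(2) by (auto simp: add_pos_nonneg add_nonneg_pos)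
      then show ?thesis using uz R by (intro add_pos_nonneg[OF mult_pos_pos])
    next
      case False
      then have "i - 2 + 2 = i" by simp
      then have "i - 2 < m" "\<theta> $ (i - 2 + 2) \<noteq> 0" using i by (linarith, simp)
      then have "?R > 0" by (intro sum_pos2[of _ "i - 2"]) auto
      then show ?thesis using uz by (intro add_nonneg_pos mult_nonneg_nonneg) auto
    qed
    then show ?thesis using ge by linarith
  qed
  then have "kaehler n (diag_form (singleton_fun n (\<lambda>j. of_real (c j))))"
    by (rule kaehler_diag_form_singleton_fun)
  moreover have "(\<lambda>I J. \<Sum>a<?k. \<Sum>b<?k. \<theta> $ a * cnj (\<theta> $ b) * (witness n ?k s t $$ (a, b)) I J)
      = diag_form (singleton_fun n (\<lambda>j. of_real (c j)))"
  proof (intro ext)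
    fix I J :: "nat set"
    have "(\<Sum>a<?k. \<Sum>b<?k. \<theta> $ a * cnj (\<theta> $ b) * (witness n ?k s t $$ (a, b)) I J)
      = (\<Sum>a<?k. \<Sum>b<?k. \<Sum>j<n. (if I = {j} \<and> J = {j} then \<i> / 2 else 0) * (\<theta> $ a * cnj (\<theta> $ b) * entry s t a b j))"
      by (intro sum.cong refl) (auto simp: witness_def singleton_fun_form_eq sum_distrib_left intro!: sum.cong)
    also have "\<dots> = (\<Sum>j<n. \<Sum>a<?k. \<Sum>b<?k. (if I = {j} \<and> J = {j} then \<i> / 2 else 0) * (\<theta> $ a * cnj (\<theta> $ b) * entry s t a b j))"
      by (subst (2) sum.swap, subst sum.swap) (rule refl)
    also have "\<dots> = diag_form (singleton_fun n (\<lambda>j. of_real (c j))) I J"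
      unfolding singleton_fun_form_eq by (simp only: sum_distrib_left[symmetric] c) (intro sum.cong refl, simp)
    finally show "(\<Sum>a<?k. \<Sum>b<?k. \<theta> $ a * cnj (\<theta> $ b) * (witness n ?k s t $$ (a, b)) I J)
      = diag_form (singleton_fun n (\<lambda>j. of_real (c j))) I J" .
  qed
  ultimately show "kaehler n (\<lambda>I J. \<Sum>a<?k. \<Sum>b<?k. \<theta> $ a * cnj (\<theta> $ b) * (witness n ?k s t $$ (a, b)) I J)"
    by simp
qed

section \<open>Singularity of the Lefschetz map\<close>

lemma lefschetz_diag_form_imp:
  assumes "lefschetz n p q \<Omega>" "\<alpha> \<in> forms n p q" "wedge \<alpha> \<Omega> = (\<lambda>I J. 0)"
  shows "\<alpha> = (\<lambda>I J. 0)"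
proof -
  have "(\<lambda>I J. 0) \<in> forms n p q" by (simp add: forms_def)
  moreover have "lefschetz_map \<Omega> (\<lambda>I J. 0) = lefschetz_map \<Omega> \<alpha>"
    using assms(3) by (simp add: lefschetz_map_def) (simp add: wedge_def)
  ultimately show ?thesis
    using assms(1,2) unfolding lefschetz_def bij_betw_def by (metis inj_onD)
qed

text \<open>This is the path condition at its starting point, with \<open>r = 0\<close>.\<close>

lemma hodge_riemann_imp_lefschetz:
  assumes "hodge_riemann n k \<omega> p q (diag_form f)"
  shows "lefschetz n p q (diag_form f)"
proof -
  obtain \<gamma> :: "real \<Rightarrow> form" where "\<gamma> 0 = diag_form f"
    "lefschetz n (p - 0) (q - 0) (wedge (\<gamma> 0) (wedge_power \<omega> (2 * 0)))"
    using assms unfolding hodge_riemann_def by (metis atLeastAtMost_iff le0 order_refl zero_le_one)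
  then show ?thesis
    by (simp add: wedge_power_def wedge_list_def wedge_diag_form_one)
qed

theorem theorem3:
  fixes n k :: nat
  assumes "n \<ge> 6" and "2 \<le> k" and "k \<le> n - 4"
  shows "\<exists>M. hermitian_form_mat n k M \<and> griffiths_positive n k M \<and> SD n k M \<and>
           \<not> lefschetz n 2 (n - k - 2) (form_det M) \<and>
           (\<forall>\<omega>. kaehler n \<omega> \<longrightarrow> form_det M \<notin> hodge_riemann_cone n k \<omega>)"
proof -
  define m where "m = k - 2"
  \<comment> \<open>With \<open>N = m + 6 = k + 4\<close> the set \<open>Q\<close> has
    \<open>n - k - 4\<close> elements, so \<open>\<alpha>\<close> below has bidegree
    \<open>(2, n - k - 2)\<close>.\<close>
  have k: "k = m + 2" and N: "m + 6 \<le> n" and q: "n - k - 2 = n - (m + 6) + 2"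
    using assms by (auto simp: m_def)
  obtain s t v i where st: "0 < s" "0 \<le> t" "t < 1" and i: "i < 4" "i \<le> m + 1" "v i \<noteq> 0"
    and ker: "\<And>p q. p < 4 \<Longrightarrow> q < 4 \<Longrightarrow> pair_type p q \<le> m + 1 \<Longrightarrow>
       mult_sum s t v (remove_pair (class_sizes m) p q) = 0"
    by (rule ex_mult_sum_zero[of m]) blast
  define M where "M = witness n k s t"
  obtain f where det: "form_det M = diag_form f"
    and supp: "\<And>S. f S \<noteq> 0 \<Longrightarrow> S \<subseteq> {..<n} \<and> card S = k"
    and f: "\<And>S. S \<subseteq> {..<n} \<Longrightarrow> card S = k \<Longrightarrow> f S = of_real (fact m * pair_sum (gram s t) (class_count S))"
    using form_det_witness[OF st(2), of n m s] unfolding M_def k by blast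
  define \<alpha> where "\<alpha> = pair_form n (m + 6) (pair_weight v)"
  have \<alpha>: "\<alpha> \<in> forms n 2 (n - k - 2)"
    unfolding \<alpha>_def q by (rule pair_form_in_forms[OF N])
  have "wedge \<alpha> (diag_form f) = (\<lambda>I J. 0)"
    unfolding \<alpha>_def
  proof (rule wedge_pair_form_eq_0[OF supp])
    fix I assume I: "I \<subseteq> {..<m + 6}" "card I = k + 2"
    have fin: "finite I" using I(1) finite_subset by blast
    have "(\<Sum>A | A \<subseteq> I \<and> card A = 2. of_real (pair_weight v A) * f (I - A))
      = (\<Sum>A | A \<subseteq> I \<and> card A = 2. of_real (fact m * (pair_weight v A * pair_sum (gram s t) (class_count (I - A)))))"
    proof (intro sum.cong refl)
      fix A assume A: "A \<in> {A. A \<subseteq> I \<and> card A = 2}"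
      then have "card (I - A) = k" using I(2) fin by (auto simp: card_Diff_subset finite_subset)
      moreover have "I - A \<subseteq> {..<n}" using I(1) N by fastforce
      ultimately show "of_real (pair_weight v A) * f (I - A)
          = of_real (fact m * (pair_weight v A * pair_sum (gram s t) (class_count (I - A))))"
        by (simp add: f)
    qed
    also have "\<dots> = of_real (fact m * (\<Sum>A | A \<subseteq> I \<and> card A = 2.
        pair_weight v A * pair_sum (gram s t) (class_count (I - A))))"
      by (simp only: of_real_sum sum_distrib_left)
    also have "\<dots> = 0"
      using I k by (subst sum_pair_weight_gram[OF _ _ ker]) auto
    finally show "(\<Sum>A | A \<subseteq> I \<and> card A = 2. of_real (pair_weight v A) * f (I - A)) = 0" .
  qed
  moreover have "\<alpha> \<noteq> (\<lambda>I J. 0)"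
  proof -
    \<comment> \<open>A nonzero coefficient is found at a pair of type \<open>i\<close>; the indices
      6 and 7 are available when needed because \<open>i \<le> m + 1\<close>.\<close>
    obtain x y where xy: "x < m + 6" "y < m + 6" "x \<noteq> y" "pair_type (cls x) (cls y) = i"
    proof -
      have "i = 0 \<or> i = 1 \<or> i = 2 \<or> i = 3" using i(1) by linarith
      then show ?thesis
        using i(2) that[of 0 3] that[of 0 1] that[of 0 6] that[of 6 7]
        by (elim disjE) (simp_all add: cls_def pair_type_def)
    qed
    then have "\<alpha> {x, y} ({x, y} \<union> {m + 6..<n}) = of_real (2 * v i)"
      by (simp add: \<alpha>_def pair_form_def pair_weight_insert)
    then show ?thesis using i(3) by auto
  qed
  ultimately have not_lefschetz: "\<not> lefschetz n 2 (n - k - 2) (form_det M)"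
    using lefschetz_diag_form_imp \<alpha> unfolding det by blast
  moreover have "form_det M \<notin> hodge_riemann_cone n k \<omega>" for \<omega>
  proof
    assume "form_det M \<in> hodge_riemann_cone n k \<omega>"
    moreover have "2 + (n - k - 2) + k = n" using N k by simp
    ultimately have "hodge_riemann n k \<omega> 2 (n - k - 2) (form_det M)"
      unfolding hodge_riemann_cone_def by blast
    then show False using hodge_riemann_imp_lefschetz not_lefschetz unfolding det by blast
  qed
  ultimately show ?thesis
    using hermitian_form_mat_witness SD_witness griffiths_positive_witness[OF st, of n m]
    unfolding M_def k by blast
qed

end
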